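(* Let $\Delta$ be an irreducible reduced root system not of type $A_n$, with highest root $\theta$, and let $S\subset\Pi_l$ be nonempty. Then the map $\eta\mapsto\theta-\eta$ is a bijection from the set of minimal elements of $\bigcap_{\alpha\in S}I(\alpha)_{\sf min}$ onto the set of maximal elements of $\Delta^+\setminus\bigcup_{\alpha\in S}I(\alpha)_{\sf max}$ (minimal/maximal with respect to $\preccurlyeq$).
   Context: $\Delta^+$, $\Pi$: positive and simple roots; $W$ the Weyl group, $(\ ,\ )$ a $W$-invariant inner product; $\mu\preccurlyeq\nu$ iff $\nu-\mu$ is a non-negative integral combination of simple roots. $\Delta^+_l$ is the set of long positive roots and $\Pi_l=\Pi\cap\Delta^+_l$. $\mathcal H=\{\gamma\in\Delta^+\mid(\gamma,\theta)>0\}$. An upper ideal of $\Delta^+$ is $I\subset\Delta^+$ with $\gamma\in I,\nu\in\Delta^+,\nu+\gamma\in\Delta^+\Rightarrow\nu+\gamma\in I$; it is abelian if $\gamma'+\gamma''\notin\Delta^+$ for all $\gamma',\gamma''\in I$. For $w\in W$, $N(w)=\{\gamma\in\Delta^+\mid w(\gamma)\in-\Delta^+\}$. For $\mu\in\Delta^+_l$, let $w_\mu$ be the unique minimal-length element of $W$ with $w_\mu(\theta)=\mu$ and $I(\mu)_{\sf min}=\{\theta\}\cup\{\theta-\gamma\mid\gamma\in N(w_\mu)\}$ (an abelian upper ideal contained in $\mathcal H$). It is known that among nonempty abelian upper ideals $I$ with $I\cap\mathcal H=I(\mu)_{\sf min}$ there is a unique maximal one, denoted $I(\mu)_{\sf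 max}$; the $I(\alpha)_{\sf max}$, $\alpha\in\Pi_l$, are exactly the maximal abelian upper ideals. *)

theory Defs
  imports "HOL-Analysis.Analysis"
begin

definition refl :: "'a::real_inner \<Rightarrow> 'a \<Rightarrow> 'a" where
  "refl \<alpha> x = x - (2 * (x \<bullet> \<alpha>) / (\<alpha> \<bullet> \<alpha>)) *\<^sub>R \<alpha>"

definition root_system :: "'a::euclidean_space set \<Rightarrow> bool" where
  "root_system R \<longleftrightarrow> finite R \<and> 0 \<notin> R \<and> span R = UNIV \<and>
     (\<forall>\<alpha>\<in>R. \<forall>\<beta>\<in>R. refl \<alpha> \<beta> \<in> R) \<and>
     (\<forall>\<alpha>\<in>R. \<forall>\<beta>\<in>R. 2 * (\<beta> \<bullet> \<alpha>) / (\<alpha> \<bullet> \<alpha>) \<in> \<int>)"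

definition reduced :: "'a::euclidean_space set \<Rightarrow> bool" where
  "reduced R \<longleftrightarrow> (\<forall>\<alpha>\<in>R. \<forall>c::real. c *\<^sub>R \<alpha> \<in> R \<longrightarrow> c = 1 \<or> c = -1)"

definition irreducible_rs :: "'a::euclidean_space set \<Rightarrow> bool" where
  "irreducible_rs R \<longleftrightarrow> R \<noteq> {} \<and> \<not> (\<exists>A B. A \<noteq> {} \<and> B \<noteq> {} \<and> A \<union> B = R \<and> A \<inter> B = {} \<and>
      (\<forall>\<alpha>\<in>A. \<forall>\<beta>\<in>B. \<alpha> \<bullet> \<beta> = 0))"

definition nonneg_comb :: "'a::euclidean_space set \<Rightarrow> 'a \<Rightarrow> bool" where
  "nonneg_comb P v \<longleftrightarrow> (\<exists>c::'a \<Rightarrow> int. (\<forall>\<alpha>\<in>P. 0 \<le> c \<alpha>) \<and> v = (\<Sum>\<alpha>\<in>P. of_int (c \<alpha>) *\<^sub>R \<alpha>))"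

definition is_base :: "'a::euclidean_space set \<Rightarrow> 'a set \<Rightarrow> bool" where
  "is_base R P \<longleftrightarrow> P \<subseteq> R \<and> independent P \<and>
     (\<forall>\<beta>\<in>R. nonneg_comb P \<beta> \<or> nonneg_comb P (- \<beta>))"

definition pos_roots :: "'a::euclidean_space set \<Rightarrow> 'a set \<Rightarrow> 'a set" where
  "pos_roots R P = {\<beta>\<in>R. nonneg_comb P \<beta>}"

definition rprec :: "'a::euclidean_space set \<Rightarrow> 'a \<Rightarrow> 'a \<Rightarrow> bool" where
  "rprec P \<mu> \<nu> \<longleftrightarrow> nonneg_comb P (\<nu> - \<mu>)"

definition highest_root :: "'a::euclidean_space set \<Rightarrow> 'a set \<Rightarrow> 'a \<Rightarrow> bool" where
  "highest_root R P \<theta> \<longleftrightarrow> \<theta> \<in> pos_roots R P \<and> (\<forall>\<beta>\<in>pos_roots R P. rprec P \<beta> \<theta>)"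

definition type_A :: "'a::euclidean_space set \<Rightarrow> bool" where
  "type_A P \<longleftrightarrow> (\<exists>(n::nat) f. bij_betw f {1..n} P \<and>
     (\<forall>i\<in>{1..n}. \<forall>j\<in>{1..n}. i \<noteq> j \<longrightarrow>
        (if i = j + 1 \<or> j = i + 1
         then 2 * (f i \<bullet> f j) / (f j \<bullet> f j) = -1 \<and> 2 * (f i \<bullet> f j) / (f i \<bullet> f i) = -1
         else f i \<bullet> f j = 0)))"

definition long_roots :: "'a::euclidean_space set \<Rightarrow> 'a set" where
  "long_roots R = {\<alpha>\<in>R. \<forall>\<beta>\<in>R. \<beta> \<bullet> \<beta> \<le> \<alpha> \<bullet> \<alpha>}"

definition pos_long_roots :: "'a::euclidean_space set \<Rightarrow> 'a set \<Rightarrow> 'a set" where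
  "pos_long_roots R P = pos_roots R P \<inter> long_roots R"

definition simple_long_roots :: "'a::euclidean_space set \<Rightarrow> 'a set \<Rightarrow> 'a set" where
  "simple_long_roots R P = P \<inter> pos_long_roots R P"

definition H_set :: "'a::euclidean_space set \<Rightarrow> 'a set \<Rightarrow> 'a \<Rightarrow> 'a set" where
  "H_set R P \<theta> = {\<gamma>\<in>pos_roots R P. \<gamma> \<bullet> \<theta> > 0}"

inductive_set weyl :: "'a::euclidean_space set \<Rightarrow> ('a \<Rightarrow> 'a) set" for R where
  weyl_id: "id \<in> weyl R"
| weyl_step: "w \<in> weyl R \<Longrightarrow> \<alpha> \<in> R \<Longrightarrow> refl \<alpha> \<circ> w \<in> weyl R"

definition weyl_length :: "'a::euclidean_space set \<Rightarrow> ('a \<Rightarrow> 'a) \<Rightarrow> nat" where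
  "weyl_length P w = (LEAST k. \<exists>as. length as = k \<and> set as \<subseteq> P \<and>
       w = foldr (\<lambda>\<alpha> f. refl \<alpha> \<circ> f) as id)"

definition inv_set :: "'a::euclidean_space set \<Rightarrow> 'a set \<Rightarrow> ('a \<Rightarrow> 'a) \<Rightarrow> 'a set" where
  "inv_set R P w = {\<gamma>\<in>pos_roots R P. w \<gamma> \<in> uminus ` pos_roots R P}"

definition w_of :: "'a::euclidean_space set \<Rightarrow> 'a set \<Rightarrow> 'a \<Rightarrow> 'a \<Rightarrow> ('a \<Rightarrow> 'a)" where
  "w_of R P \<theta> \<mu> = (THE w. w \<in> weyl R \<and> w \<theta> = \<mu> \<and>
      (\<forall>w'\<in>weyl R. w' \<theta> = \<mu> \<longrightarrow> weyl_length P w \<le> weyl_length P w'))"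

definition I_min :: "'a::euclidean_space set \<Rightarrow> 'a set \<Rightarrow> 'a \<Rightarrow> 'a \<Rightarrow> 'a set" where
  "I_min R P \<theta> \<mu> = {\<theta>} \<union> {\<theta> - \<gamma> | \<gamma>. \<gamma> \<in> inv_set R P (w_of R P \<theta> \<mu>)}"

definition upper_ideal :: "'a::euclidean_space set \<Rightarrow> 'a set \<Rightarrow> 'a set \<Rightarrow> bool" where
  "upper_ideal R P I \<longleftrightarrow> I \<subseteq> pos_roots R P \<and>
     (\<forall>\<gamma>\<in>I. \<forall>\<nu>\<in>pos_roots R P. \<nu> + \<gamma> \<in> pos_roots R P \<longrightarrow> \<nu> + \<gamma> \<in> I)"

definition abelian_ideal :: "'a::euclidean_space set \<Rightarrow> 'a set \<Rightarrow> 'a set \<Rightarrow> bool" where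
  "abelian_ideal R P I \<longleftrightarrow> (\<forall>\<gamma>1\<in>I. \<forall>\<gamma>2\<in>I. \<gamma>1 + \<gamma>2 \<notin> pos_roots R P)"

definition I_max :: "'a::euclidean_space set \<Rightarrow> 'a set \<Rightarrow> 'a \<Rightarrow> 'a \<Rightarrow> 'a set" where
  "I_max R P \<theta> \<mu> = (THE I.
     let F = {J. J \<noteq> {} \<and> upper_ideal R P J \<and> abelian_ideal R P J \<and>
                 J \<inter> H_set R P \<theta> = I_min R P \<theta> \<mu>}
     in I \<in> F \<and> (\<forall>J\<in>F. I \<subseteq> J \<longrightarrow> J = I))"

definition minimal_elems :: "'a::euclidean_space set \<Rightarrow> 'a set \<Rightarrow> 'a set" where
  "minimal_elems P X = {x\<in>X. \<forall>y\<in>X. rprec P y x \<longrightarrow> y = x}"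

definition maximal_elems :: "'a::euclidean_space set \<Rightarrow> 'a set \<Rightarrow> 'a set" where
  "maximal_elems P X = {x\<in>X. \<forall>y\<in>X. rprec P x y \<longrightarrow> y = x}"

end

theory Submission
  imports Defs
begin

text \<open>
  Let \<open>H\<close> be the set of positive roots not orthogonal to \<open>\<theta>\<close>. For a long simple root \<open>\<alpha>\<close>,
  \<open>I(\<alpha>)\<^sub>m\<^sub>i\<^sub>n\<close> consists of the \<open>\<gamma> \<in> H\<close> with \<open>w\<^sub>\<alpha> \<gamma>\<close> positive and contains exactly one of \<open>\<gamma>\<close>,
  \<open>\<theta> - \<gamma>\<close> for each \<open>\<gamma> \<in> H\<close>, \<open>\<gamma> \<noteq> \<theta>\<close>. Consequently \<open>I(\<alpha>)\<^sub>m\<^sub>a\<^sub>x\<close> is the centralizer of \<open>I(\<alpha>)\<^sub>m\<^sub>i\<^sub>n\<close>: the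
  positive roots \<open>\<gamma>\<close> such that \<open>\<gamma> + \<eta>\<close> is a root for no \<open>\<eta> \<in> I(\<alpha>)\<^sub>m\<^sub>i\<^sub>n\<close>. If \<open>\<gamma> + \<eta>\<close> is a root, then both
  summands can be raised until the sum is \<open>\<theta>\<close>; so \<open>\<gamma> \<notin> I(\<alpha>)\<^sub>m\<^sub>a\<^sub>x\<close> iff \<open>\<gamma> \<preceq> \<theta> - \<eta>\<close> for some
  \<open>\<eta> \<in> I(\<alpha>)\<^sub>m\<^sub>i\<^sub>n\<close>. Outside type \<open>A\<^sub>n\<close> a single simple root is not orthogonal to \<open>\<theta>\<close>, and it lies in the
  support of every element of \<open>H\<close>; roots with a common simple root in their supports and a common
  upper bound \<open>v\<close> in the root lattice have a common upper bound among the roots below \<open>v\<close>. Taking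
  \<open>v = \<theta> - \<gamma>\<close>, the witnesses \<open>\<eta>\<close> for the various \<open>\<alpha> \<in> S\<close> can be replaced by a single one.
\<close>

section \<open>Roots and the root order\<close>

locale based_root_system =
  fixes R P :: "'a::euclidean_space set"
  assumes rs: "root_system R" and red: "reduced R" and base: "is_base R P"
begin

abbreviation pos :: "'a set" where "pos \<equiv> pos_roots R P"
abbreviation prec :: "'a \<Rightarrow> 'a \<Rightarrow> bool" (infix "\<preceq>" 50) where "x \<preceq> y \<equiv> rprec P x y"

text \<open>\<open>representation P\<close> vanishes off the span of \<open>P\<close>; since the
  base spans the whole space, \<open>cf\<close> is a linear coordinate function on every
  vector.\<close>

definition cf :: "'a \<Rightarrow> 'a \<Rightarrow> real" where "cf = representation P"

text \<open>The pairing of \<open>x\<close> with the coroot of \<open>y\<close>: linear in the first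
  argument only.\<close>

definition cartan :: "'a \<Rightarrow> 'a \<Rightarrow> real" where "cartan x y = 2 * (x \<bullet> y) / (y \<bullet> y)"

lemma finite_R: "finite R" and zero_notin_R: "0 \<notin> R"
  and refl_in_R: "\<alpha> \<in> R \<Longrightarrow> \<beta> \<in> R \<Longrightarrow> refl \<alpha> \<beta> \<in> R"
  and cartan_Ints: "\<alpha> \<in> R \<Longrightarrow> \<beta> \<in> R \<Longrightarrow> cartan \<beta> \<alpha> \<in> \<int>"
  using rs by (auto simp: root_system_def cartan_def)

lemma P_subset: "P \<subseteq> R" and indep: "independent P"
  using base by (auto simp: is_base_def)

lemma P_in_R: "\<beta> \<in> P \<Longrightarrow> \<beta> \<in> R"
  using P_subset by blast

lemma finite_P: "finite P"
  using P_subset finite_R finite_subset by blast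

lemma inner_pos: "\<alpha> \<in> R \<Longrightarrow> \<alpha> \<bullet> \<alpha> > 0"
  using zero_notin_R by auto

lemma refl_eq: "refl \<alpha> x = x - cartan x \<alpha> *\<^sub>R \<alpha>"
  by (simp add: refl_def cartan_def)

lemma cartan_self: "\<alpha> \<in> R \<Longrightarrow> cartan \<alpha> \<alpha> = 2"
  using inner_pos[of \<alpha>] by (simp add: cartan_def)

lemma cartan_pos_iff: "\<alpha> \<in> R \<Longrightarrow> cartan x \<alpha> > 0 \<longleftrightarrow> x \<bullet> \<alpha> > 0"
  using inner_pos[of \<alpha>] by (simp add: cartan_def pos_less_divide_eq del: inner_gt_zero_iff)

lemma cartan_neg_iff: "\<alpha> \<in> R \<Longrightarrow> cartan x \<alpha> < 0 \<longleftrightarrow> x \<bullet> \<alpha> < 0"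
  using inner_pos[of \<alpha>] by (simp add: cartan_def pos_divide_less_eq del: inner_gt_zero_iff)

lemma uminus_in_R: "\<alpha> \<in> R \<Longrightarrow> - \<alpha> \<in> R"
  using refl_in_R[of \<alpha> \<alpha>] cartan_self[of \<alpha>] by (simp add: refl_eq scaleR_2)

text \<open>\<open>is_base\<close> demands only independence of \<open>P\<close>; spanning is
  inherited from \<open>R\<close>, whose elements are combinations of \<open>P\<close> up to
  sign.\<close>

lemma span_P: "span P = UNIV"
proof -
  have "nonneg_comb P v \<Longrightarrow> v \<in> span P" for v
    by (auto simp: nonneg_comb_def intro!: span_sum intro: span_scale span_base)
  then have "R \<subseteq> span P"
    using base span_neg[of _ P] by (fastforce simp: is_base_def)
  then show ?thesis
    using rs span_mono[of R "span P"] by (auto simp: root_system_def span_span)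
qed

section \<open>Coordinates with respect to the base\<close>

lemma cf_add: "cf (x + y) \<beta> = cf x \<beta> + cf y \<beta>"
  and cf_diff: "cf (x - y) \<beta> = cf x \<beta> - cf y \<beta>"
  and cf_uminus: "cf (- x) \<beta> = - cf x \<beta>"
  and cf_scale: "cf (c *\<^sub>R x) \<beta> = c * cf x \<beta>"
  and cf_zero: "cf 0 \<beta> = 0"
  using indep span_P
  by (simp_all add: cf_def representation_add representation_diff representation_neg
      representation_scale representation_zero)

lemma cf_basis: "\<beta> \<in> P \<Longrightarrow> cf \<beta> \<gamma> = (if \<gamma> = \<beta> then 1 else 0)"
  using indep by (simp add: cf_def representation_basis)

lemmas cf_simps = cf_add cf_diff cf_uminus cf_scale cf_zero

lemma cf_sum: "cf (\<Sum>i\<in>A. f i) \<beta> = (\<Sum>i\<in>A. cf (f i) \<beta>)"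
  by (induction A rule: infinite_finite_induct) (simp_all add: cf_simps)

lemma cf_expand: "x = (\<Sum>\<beta>\<in>P. cf x \<beta> *\<^sub>R \<beta>)"
  using sum_representation_eq[OF indep _ finite_P order.refl] span_P by (simp add: cf_def)

lemma cf_eqI: "(\<And>\<beta>. \<beta> \<in> P \<Longrightarrow> cf x \<beta> = cf y \<beta>) \<Longrightarrow> x = y"
  using cf_expand[of x] cf_expand[of y] by (metis (no_types, lifting) sum.cong)

lemma inner_expand: "x \<bullet> y = (\<Sum>\<beta>\<in>P. cf x \<beta> * (\<beta> \<bullet> y))"
  using arg_cong[OF cf_expand[of x], of "\<lambda>z. z \<bullet> y"] by (simp add: inner_sum_left)

lemma cf_comb: "\<gamma> \<in> P \<Longrightarrow> cf (\<Sum>\<beta>\<in>P. f \<beta> *\<^sub>R \<beta>) \<gamma> = f \<gamma>"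
proof -
  assume g: "\<gamma> \<in> P"
  have "cf (\<Sum>\<beta>\<in>P. f \<beta> *\<^sub>R \<beta>) \<gamma> = (\<Sum>\<beta>\<in>P. if \<gamma> = \<beta> then f \<beta> else 0)"
    unfolding cf_sum by (intro sum.cong) (auto simp: cf_scale cf_basis)
  then show ?thesis using g finite_P by simp
qed

lemma nonneg_comb_iff: "nonneg_comb P x \<longleftrightarrow> (\<forall>\<beta>\<in>P. cf x \<beta> \<in> \<nat>)"
proof
  assume "nonneg_comb P x"
  then obtain c :: "'a \<Rightarrow> int" where "\<forall>\<alpha>\<in>P. 0 \<le> c \<alpha>"
    and "x = (\<Sum>\<alpha>\<in>P. of_int (c \<alpha>) *\<^sub>R \<alpha>)"
    unfolding nonneg_comb_def by blast
  then show "\<forall>\<beta>\<in>P. cf x \<beta> \<in> \<nat>"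
    using cf_comb[of _ "\<lambda>\<alpha>. real_of_int (c \<alpha>)"] by (auto simp: Nats_altdef2)
next
  assume n: "\<forall>\<beta>\<in>P. cf x \<beta> \<in> \<nat>"
  \<comment> \<open>\<open>nonneg_comb\<close> asks for an integer-valued function; the floor is
    exact on these coordinates.\<close>
  then have fl: "\<forall>\<beta>\<in>P. \<lfloor>cf x \<beta>\<rfloor> \<ge> 0 \<and> of_int \<lfloor>cf x \<beta>\<rfloor> = cf x \<beta>"
    by (auto simp: Nats_altdef2)
  have "(\<Sum>\<beta>\<in>P. of_int \<lfloor>cf x \<beta>\<rfloor> *\<^sub>R \<beta>) = (\<Sum>\<beta>\<in>P. cf x \<beta> *\<^sub>R \<beta>)"
    using fl by (intro sum.cong) auto
  then have "(\<Sum>\<beta>\<in>P. of_int \<lfloor>cf x \<beta>\<rfloor> *\<^sub>R \<beta>) = x"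
    by (simp only: cf_expand[of x, symmetric])
  with fl show "nonneg_comb P x"
    unfolding nonneg_comb_def by (intro exI[of _ "\<lambda>\<beta>. \<lfloor>cf x \<beta>\<rfloor>"]) metis
qed

section \<open>The root order and positivity\<close>

lemma rprec_iff: "x \<preceq> y \<longleftrightarrow> (\<forall>\<beta>\<in>P. cf y \<beta> - cf x \<beta> \<in> \<nat>)"
  by (simp add: rprec_def nonneg_comb_iff cf_simps)

lemma rprec_cf_le: "x \<preceq> y \<Longrightarrow> \<beta> \<in> P \<Longrightarrow> cf x \<beta> \<le> cf y \<beta>"
  unfolding rprec_iff Nats_altdef2 by fastforce

lemma rprec_refl: "x \<preceq> x"
  by (simp add: rprec_iff)

lemma rprec_trans: "x \<preceq> y \<Longrightarrow> y \<preceq> z \<Longrightarrow> x \<preceq> z"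
proof -
  assume "x \<preceq> y" "y \<preceq> z"
  then have "\<forall>\<beta>\<in>P. (cf y \<beta> - cf x \<beta>) + (cf z \<beta> - cf y \<beta>) \<in> \<nat>"
    unfolding rprec_iff by (blast intro: Nats_add)
  then show "x \<preceq> z" by (simp add: rprec_iff)
qed

lemma rprec_antisym: "x \<preceq> y \<Longrightarrow> y \<preceq> x \<Longrightarrow> x = y"
  by (intro cf_eqI order.antisym rprec_cf_le)

lemma rprec_diff_swap: "x \<preceq> z - y \<longleftrightarrow> y \<preceq> z - x"
  by (simp add: rprec_def algebra_simps)

lemma rprec_diff_iff: "z - x \<preceq> z - y \<longleftrightarrow> y \<preceq> x"
  by (simp add: rprec_def)

lemma cf_root_Ints: "\<gamma> \<in> R \<Longrightarrow> \<beta> \<in> P \<Longrightarrow> cf \<gamma> \<beta> \<in> \<int>"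
proof -
  assume g: "\<gamma> \<in> R" and b: "\<beta> \<in> P"
  have "cf \<gamma> \<beta> \<in> \<nat> \<or> - cf \<gamma> \<beta> \<in> \<nat>"
    using g b base by (auto simp: is_base_def nonneg_comb_iff cf_simps)
  then show ?thesis using Nats_subset_Ints minus_in_Ints_iff by blast
qed

lemma pos_iff: "\<gamma> \<in> pos \<longleftrightarrow> \<gamma> \<in> R \<and> (\<forall>\<beta>\<in>P. cf \<gamma> \<beta> \<ge> 0)"
  using cf_root_Ints[of \<gamma>] by (auto simp: pos_roots_def nonneg_comb_iff Nats_altdef2)

lemma pos_in_R: "\<gamma> \<in> pos \<Longrightarrow> \<gamma> \<in> R"
  and pos_cf_nonneg: "\<gamma> \<in> pos \<Longrightarrow> \<beta> \<in> P \<Longrightarrow> cf \<gamma> \<beta> \<ge> 0"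
  by (auto simp: pos_iff)

lemma pos_or_neg: "\<gamma> \<in> R \<Longrightarrow> \<gamma> \<in> pos \<or> - \<gamma> \<in> pos"
  using base uminus_in_R by (auto simp: is_base_def pos_roots_def)

lemma ex_cf_nonzero: "\<gamma> \<in> R \<Longrightarrow> \<exists>\<beta>\<in>P. cf \<gamma> \<beta> \<noteq> 0"
  using cf_eqI[of \<gamma> 0] zero_notin_R by (auto simp: cf_simps)

lemma ex_cf_pos: "\<gamma> \<in> pos \<Longrightarrow> \<exists>\<beta>\<in>P. cf \<gamma> \<beta> > 0"
  by (metis ex_cf_nonzero order_le_less pos_iff)

lemma pos_not_neg: "\<gamma> \<in> pos \<Longrightarrow> - \<gamma> \<notin> pos"
  using ex_cf_pos[of \<gamma>] pos_cf_nonneg[of "- \<gamma>"] by (force simp: cf_simps)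

text \<open>The coefficients of a root all have the same sign, so one positive coefficient
  decides.\<close>

lemma posI: "\<gamma> \<in> R \<Longrightarrow> \<beta> \<in> P \<Longrightarrow> cf \<gamma> \<beta> > 0 \<Longrightarrow> \<gamma> \<in> pos"
  using pos_or_neg[of \<gamma>] pos_cf_nonneg[of "- \<gamma>" \<beta>] by (auto simp: cf_simps)

lemma P_pos: "\<beta> \<in> P \<Longrightarrow> \<beta> \<in> pos"
  by (auto simp: pos_iff cf_basis P_in_R)

lemma pos_add_neq_0: "\<gamma> \<in> pos \<Longrightarrow> \<nu> \<in> pos \<Longrightarrow> \<gamma> + \<nu> \<noteq> 0"
  using pos_not_neg by (metis add_eq_0_iff)

lemma pos_add: "\<gamma> \<in> pos \<Longrightarrow> \<nu> \<in> pos \<Longrightarrow> \<gamma> + \<nu> \<in> R \<Longrightarrow> \<gamma> + \<nu> \<in> pos"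
  by (simp add: pos_iff cf_simps)

lemma pos_rprec_add: "\<nu> \<in> pos \<Longrightarrow> x \<preceq> x + \<nu>"
  by (simp add: rprec_def pos_roots_def)

text \<open>If the sum were simple, both summands would be supported at that simple root alone, each
  with coefficient at least 1, making the coefficient of the sum at least 2.\<close>

lemma pos_add_notin_P:
  assumes "\<gamma> \<in> pos" "\<nu> \<in> pos" shows "\<gamma> + \<nu> \<notin> P"
proof
  assume p: "\<gamma> + \<nu> \<in> P"
  have z: "cf \<gamma> \<beta> = 0 \<and> cf \<nu> \<beta> = 0" if "\<beta> \<in> P" "\<beta> \<noteq> \<gamma> + \<nu>" for \<beta>
    using cf_basis[OF p, of \<beta>] that pos_cf_nonneg[OF assms(1) that(1)]
      pos_cf_nonneg[OF assms(2) that(1)] by (auto simp: cf_simps)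
  have ge1: "cf \<xi> (\<gamma> + \<nu>) \<ge> 1" if x: "\<xi> \<in> pos" and z: "\<And>\<beta>. \<beta> \<in> P \<Longrightarrow> \<beta> \<noteq> \<gamma> + \<nu> \<Longrightarrow> cf \<xi> \<beta> = 0" for \<xi>
  proof -
    have "cf \<xi> (\<gamma> + \<nu>) > 0" using ex_cf_pos[OF x] z by force
    moreover have "cf \<xi> (\<gamma> + \<nu>) \<in> \<int>" using cf_root_Ints[OF pos_in_R[OF x] p] .
    ultimately show ?thesis by (auto elim!: Ints_cases)
  qed
  show False
    using ge1[OF assms(1)] ge1[OF assms(2)] z cf_basis[OF p, of "\<gamma> + \<nu>"] by (auto simp: cf_simps)
qed

lemma rprec_simple: "\<gamma> \<in> pos \<Longrightarrow> \<beta> \<in> P \<Longrightarrow> \<gamma> \<preceq> \<beta> \<Longrightarrow> \<gamma> = \<beta>"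
proof -
  assume g: "\<gamma> \<in> pos" and b: "\<beta> \<in> P" and le: "\<gamma> \<preceq> \<beta>"
  have z: "cf \<gamma> \<delta> = 0" if "\<delta> \<in> P" "\<delta> \<noteq> \<beta>" for \<delta>
    using rprec_cf_le[OF le that(1)] pos_cf_nonneg[OF g that(1)] cf_basis[OF b, of \<delta>] that by auto
  then have "cf \<gamma> \<beta> > 0" using ex_cf_pos[OF g] by force
  moreover have "cf \<gamma> \<beta> \<in> \<int>" using cf_root_Ints g b pos_in_R by blast
  ultimately have "cf \<gamma> \<beta> \<ge> 1" by (auto elim!: Ints_cases)
  then have "cf \<gamma> \<beta> = 1" using rprec_cf_le[OF le b] cf_basis[OF b, of \<beta>] by simp
  then show ?thesis using z b by (intro cf_eqI) (auto simp: cf_basis)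
qed

section \<open>Sums and differences of roots\<close>

lemma root_diff:
  assumes a: "\<alpha> \<in> R" and b: "\<beta> \<in> R" and p: "\<alpha> \<bullet> \<beta> > 0" and ne: "\<alpha> \<noteq> \<beta>"
  shows "\<alpha> - \<beta> \<in> R"
proof -
  \<comment> \<open>If one of the two Cartan integers is 1, a reflection yields the difference up to
    sign. If both are at least 2, then \<open>\<alpha> - \<beta>\<close> has norm 0.\<close>
  consider "cartan \<alpha> \<beta> = 1" | "cartan \<beta> \<alpha> = 1" | "cartan \<alpha> \<beta> \<ge> 2" "cartan \<beta> \<alpha> \<ge> 2"
  proof -
    have "cartan \<alpha> \<beta> > 0" "cartan \<beta> \<alpha> > 0"
      using p a b cartan_pos_iff by (auto simp: inner_commute)
    moreover have "cartan \<alpha> \<beta> \<in> \<int>" "cartan \<beta> \<alpha> \<in> \<int>" using a b cartan_Ints by auto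
    ultimately show ?thesis using that by (fastforce elim!: Ints_cases)
  qed
  then show ?thesis
  proof cases
    case 1
    then show ?thesis using refl_in_R[OF b a] by (simp add: refl_eq)
  next
    case 2
    then show ?thesis using uminus_in_R[OF refl_in_R[OF a b]] by (simp add: refl_eq)
  next
    case 3
    then have "\<alpha> \<bullet> \<beta> \<ge> \<beta> \<bullet> \<beta>" "\<alpha> \<bullet> \<beta> \<ge> \<alpha> \<bullet> \<alpha>"
      using inner_pos[OF a] inner_pos[OF b]
      by (auto simp: cartan_def pos_le_divide_eq inner_commute)
    then have "(\<alpha> - \<beta>) \<bullet> (\<alpha> - \<beta>) \<le> 0"
      by (simp add: inner_diff inner_commute)
    then show ?thesis using ne by (metis eq_iff_diff_eq_0 inner_eq_zero_iff inner_ge_zero order_antisym)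
  qed
qed

lemma root_add:
  assumes "\<alpha> \<in> R" "\<beta> \<in> R" "\<alpha> \<bullet> \<beta> < 0" "\<alpha> + \<beta> \<noteq> 0"
  shows "\<alpha> + \<beta> \<in> R"
  using root_diff[OF assms(1) uminus_in_R[OF assms(2)]] assms by (auto simp: add_eq_0_iff2)

lemma pos_root_add: "\<gamma> \<in> pos \<Longrightarrow> \<nu> \<in> pos \<Longrightarrow> \<gamma> \<bullet> \<nu> < 0 \<Longrightarrow> \<gamma> + \<nu> \<in> pos"
  by (simp add: pos_add pos_add_neq_0 pos_in_R root_add)

text \<open>Otherwise the difference is a root, and one of the two simple roots becomes a sum of two
  positive roots.\<close>

lemma simple_inner_le_0:
  assumes a: "\<alpha> \<in> P" and b: "\<beta> \<in> P" and ne: "\<alpha> \<noteq> \<beta>" shows "\<alpha> \<bullet> \<beta> \<le> 0"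
proof (rule ccontr)
  assume "\<not> \<alpha> \<bullet> \<beta> \<le> 0"
  then have "\<alpha> - \<beta> \<in> R" using root_diff assms P_in_R by auto
  then have "\<alpha> - \<beta> \<in> pos \<or> - (\<alpha> - \<beta>) \<in> pos" by (rule pos_or_neg)
  then have "\<alpha> - \<beta> \<in> pos \<or> \<beta> - \<alpha> \<in> pos" by simp
  then show False
    using pos_add_notin_P[of "\<alpha> - \<beta>" \<beta>] pos_add_notin_P[of "\<beta> - \<alpha>" \<alpha>] a b P_pos by auto
qed

text \<open>Reflecting in \<open>\<beta>\<close> changes only the coefficient at
  \<open>\<beta>\<close>. Since \<open>R\<close> is reduced, \<open>\<gamma>\<close> has another
  nonzero coefficient, which stays positive.\<close>

lemma refl_simple_pos:
  assumes b: "\<beta> \<in> P" and g: "\<gamma> \<in> pos" and ne: "\<gamma> \<noteq> \<beta>"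
  shows "refl \<beta> \<gamma> \<in> pos"
proof -
  have "\<exists>\<delta>\<in>P. \<delta> \<noteq> \<beta> \<and> cf \<gamma> \<delta> \<noteq> 0"
  proof (rule ccontr)
    assume "\<not> ?thesis"
    then have z: "\<And>\<delta>. \<delta> \<in> P \<Longrightarrow> \<delta> \<noteq> \<beta> \<Longrightarrow> cf \<gamma> \<delta> = 0" by blast
    have eq: "\<gamma> = cf \<gamma> \<beta> *\<^sub>R \<beta>"
    proof (rule cf_eqI)
      fix \<delta> assume "\<delta> \<in> P"
      then show "cf \<gamma> \<delta> = cf (cf \<gamma> \<beta> *\<^sub>R \<beta>) \<delta>"
        using z[of \<delta>] by (simp add: cf_scale cf_basis[OF b])
    qed
    then have "cf \<gamma> \<beta> *\<^sub>R \<beta> \<in> R" using pos_in_R[OF g] by metis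
    then have "cf \<gamma> \<beta> = 1 \<or> cf \<gamma> \<beta> = -1"
      using red P_in_R[OF b] unfolding reduced_def by blast
    then have "cf \<gamma> \<beta> = 1" using pos_cf_nonneg[OF g b] by auto
    then show False using ne eq by (metis scaleR_one)
  qed
  then obtain \<delta> where d: "\<delta> \<in> P" "\<delta> \<noteq> \<beta>" "cf \<gamma> \<delta> \<noteq> 0" by blast
  then have "cf (refl \<beta> \<gamma>) \<delta> > 0"
    using pos_cf_nonneg[OF g d(1)] b by (simp add: refl_eq cf_simps cf_basis)
  then show ?thesis using posI d refl_in_R g b pos_in_R P_in_R by blast
qed

section \<open>Height, and induction along the root order\<close>

definition ht :: "'a \<Rightarrow> real" where "ht x = (\<Sum>\<beta>\<in>P. cf x \<beta>)"

lemma ht_add: "ht (x + y) = ht x + ht y" and ht_diff: "ht (x - y) = ht x - ht y"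
  and ht_scale: "ht (c *\<^sub>R x) = c * ht x"
  by (simp_all add: ht_def cf_simps sum.distrib sum_subtractf sum_distrib_left)

lemma ht_simple: "\<beta> \<in> P \<Longrightarrow> ht \<beta> = 1"
  by (simp add: ht_def cf_basis finite_P)

lemma ht_pos_nonneg: "\<gamma> \<in> pos \<Longrightarrow> ht \<gamma> \<ge> 0"
  unfolding ht_def by (intro sum_nonneg) (auto intro: pos_cf_nonneg)

text \<open>Expanding one factor of \<open>x \<bullet> x\<close> in the base gives a positive sum,
  so some term is positive.\<close>

lemma ex_simple_inner_pos:
  assumes "x \<bullet> x > 0" "\<forall>\<beta>\<in>P. cf x \<beta> \<ge> 0"
  shows "\<exists>\<beta>\<in>P. cf x \<beta> > 0 \<and> x \<bullet> \<beta> > 0"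
proof (rule ccontr)
  assume neg: "\<not> ?thesis"
  have "(\<Sum>\<beta>\<in>P. cf x \<beta> * (\<beta> \<bullet> x)) \<le> 0"
  proof (rule sum_nonpos)
    fix \<beta> assume b: "\<beta> \<in> P"
    have "cf x \<beta> \<ge> 0" using assms(2) b by blast
    moreover have "cf x \<beta> = 0 \<or> \<beta> \<bullet> x \<le> 0"
      using neg b \<open>cf x \<beta> \<ge> 0\<close> by (force simp: inner_commute)
    ultimately show "cf x \<beta> * (\<beta> \<bullet> x) \<le> 0" by (auto simp: mult_nonneg_nonpos)
  qed
  then show False using assms(1) inner_expand[of x x] by simp
qed

text \<open>A non-simple positive root pairs positively with some simple root; reflecting in it
  keeps the root positive and lowers the height by at least 1.\<close>

lemma pos_induct [consumes 1, case_names simple reflect]: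
  assumes "\<gamma> \<in> pos"
    and simple: "\<And>\<beta>. \<beta> \<in> P \<Longrightarrow> Q \<beta>"
    and reflect: "\<And>\<gamma> \<beta>. \<gamma> \<in> pos \<Longrightarrow> \<beta> \<in> P \<Longrightarrow> \<gamma> \<bullet> \<beta> > 0 \<Longrightarrow> refl \<beta> \<gamma> \<in> pos \<Longrightarrow> Q (refl \<beta> \<gamma>) \<Longrightarrow> Q \<gamma>"
  shows "Q \<gamma>"
proof -
  \<comment> \<open>Height is real-valued, so the induction runs over a natural number bounding it,
    supplied at the end by the Archimedean property.\<close>
  have "\<gamma> \<in> pos \<Longrightarrow> ht \<gamma> < real n \<Longrightarrow> Q \<gamma>" for n \<gamma>
  proof (induction n arbitrary: \<gamma>)
    case 0
    then show ?case using ht_pos_nonneg[of \<gamma>] by simp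
  next
    case (Suc n)
    show ?case
    proof (cases "\<gamma> \<in> P")
      case False
      obtain \<beta> where b: "\<beta> \<in> P" "\<gamma> \<bullet> \<beta> > 0"
        using ex_simple_inner_pos[OF inner_pos[OF pos_in_R]] pos_cf_nonneg Suc.prems by meson
      have p: "refl \<beta> \<gamma> \<in> pos" using refl_simple_pos b Suc.prems False by blast
      have "cartan \<gamma> \<beta> > 0" "cartan \<gamma> \<beta> \<in> \<int>"
        using b cartan_pos_iff cartan_Ints P_in_R pos_in_R Suc.prems by auto
      then have "cartan \<gamma> \<beta> \<ge> 1" by (auto elim!: Ints_cases)
      then have "ht (refl \<beta> \<gamma>) < real n"
        using Suc.prems b by (simp add: refl_eq ht_diff ht_scale ht_simple)
      then show ?thesis using Suc b p reflect by blast
    qed (rule simple)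
  qed
  from this[OF assms(1)] show ?thesis using reals_Archimedean2[of "ht \<gamma>"] by metis
qed

text \<open>Choose \<open>\<beta>\<close> in the support of \<open>\<mu> - \<gamma>\<close> pairing
  positively with it. Either \<open>\<gamma> \<bullet> \<beta> < 0\<close> and
  \<open>\<beta>\<close> can be added to \<open>\<gamma>\<close>, or
  \<open>\<mu> \<bullet> \<beta> > 0\<close> and the argument is repeated with
  \<open>\<mu> - \<beta>\<close> in place of \<open>\<mu>\<close>.\<close>

lemma rprec_step:
  assumes "\<gamma> \<in> pos" "\<mu> \<in> pos" "\<gamma> \<preceq> \<mu>" "\<gamma> \<noteq> \<mu>"
  shows "\<exists>\<beta>\<in>P. \<gamma> + \<beta> \<in> pos \<and> \<gamma> + \<beta> \<preceq> \<mu>"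
proof -
  have "\<mu> \<in> pos \<Longrightarrow> \<gamma> \<preceq> \<mu> \<Longrightarrow> \<gamma> \<noteq> \<mu> \<Longrightarrow> ht \<mu> < real n \<Longrightarrow> ?thesis" for n
    using assms(2-)
  proof (induction n arbitrary: \<mu>)
    case 0
    then show ?case using ht_pos_nonneg[of \<mu>] by simp
  next
    case (Suc n)
    have cfle: "\<forall>\<beta>\<in>P. cf (\<mu> - \<gamma>) \<beta> \<ge> 0"
      using rprec_cf_le Suc.prems by (auto simp: cf_simps)
    obtain \<beta> where b: "\<beta> \<in> P" "cf (\<mu> - \<gamma>) \<beta> > 0" "(\<mu> - \<gamma>) \<bullet> \<beta> > 0"
      using ex_simple_inner_pos[OF _ cfle] Suc.prems by auto
    have "cf \<mu> \<beta> - cf \<gamma> \<beta> \<in> \<nat>" using Suc.prems b by (auto simp: rprec_iff)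
    then have "cf \<mu> \<beta> - cf \<gamma> \<beta> - 1 \<in> \<nat>"
      using b(2) by (auto simp: cf_simps Nats_altdef2 elim!: Ints_cases)
    then have below: "\<gamma> + \<beta> \<preceq> \<mu>"
      using Suc.prems(2) b(1) by (auto simp: rprec_iff cf_simps cf_basis algebra_simps)
    show ?case
    proof (cases "\<gamma> \<bullet> \<beta> < 0")
      case True
      then show ?thesis using below b pos_root_add assms(1) P_pos by blast
    next
      case False
      then have "\<mu> \<bullet> \<beta> > 0" using b by (simp add: inner_diff_left)
      moreover have ne: "\<mu> \<noteq> \<beta>" using rprec_simple assms(1) b(1) Suc.prems by blast
      ultimately have r: "\<mu> - \<beta> \<in> R" using root_diff Suc.prems b pos_in_R P_in_R by blast
      have le: "\<gamma> \<preceq> \<mu> - \<beta>" using below by (simp add: rprec_def algebra_simps)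
      have p: "\<mu> - \<beta> \<in> pos"
        using r rprec_cf_le[OF le] pos_cf_nonneg[OF assms(1)] by (force simp: pos_iff)
      show ?thesis
      proof (cases "\<gamma> = \<mu> - \<beta>")
        case True
        then have "\<gamma> + \<beta> = \<mu>" by simp
        then show ?thesis using b Suc.prems(1) rprec_refl by metis
      next
        case False
        obtain \<delta> where "\<delta> \<in> P" "\<gamma> + \<delta> \<in> pos" "\<gamma> + \<delta> \<preceq> \<mu> - \<beta>"
          using Suc.IH[OF p le False] Suc.prems p le False b by (auto simp: ht_diff ht_simple)
        moreover have "\<mu> - \<beta> \<preceq> \<mu>" using pos_rprec_add[OF P_pos[OF b(1)], of "\<mu> - \<beta>"] by simp
        ultimately show ?thesis using rprec_trans by blast
      qed
    qed
  qed
  from this[OF assms(2-)] show ?thesis using reals_Archimedean2[of "ht \<mu>"] by metis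
qed

text \<open>Ideals are defined by adding single positive roots; by \<open>rprec_step\<close>
  comparable roots are joined by a chain of such additions.\<close>

lemma upper_ideal_rprec:
  assumes "upper_ideal R P I" "\<gamma> \<in> I" "\<mu> \<in> pos" "\<gamma> \<preceq> \<mu>"
  shows "\<mu> \<in> I"
proof -
  have "\<gamma> \<in> I \<Longrightarrow> \<gamma> \<preceq> \<mu> \<Longrightarrow> ht \<mu> - ht \<gamma> < real n \<Longrightarrow> \<mu> \<in> I" for n \<gamma>
  proof (induction n arbitrary: \<gamma>)
    case 0
    have "ht \<gamma> \<le> ht \<mu>"
      unfolding ht_def using rprec_cf_le[OF 0(2)] by (rule sum_mono)
    then show ?case using 0(3) by simp
  next
    case (Suc n)
    show ?case
    proof (cases "\<gamma> = \<mu>")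
      case False
      have g: "\<gamma> \<in> pos" using Suc.prems assms(1) by (auto simp: upper_ideal_def)
      obtain \<beta> where b: "\<beta> \<in> P" "\<gamma> + \<beta> \<in> pos" "\<gamma> + \<beta> \<preceq> \<mu>"
        using rprec_step[OF g assms(3) Suc.prems(2) False] by blast
      then have "\<gamma> + \<beta> \<in> I"
        using assms(1) Suc.prems(1) P_pos by (auto simp: upper_ideal_def add.commute)
      then show ?thesis using Suc.IH[of "\<gamma> + \<beta>"] Suc.prems b by (simp add: ht_add ht_simple)
    qed (use Suc in simp)
  qed
  from this[OF assms(2,4)] show ?thesis using reals_Archimedean2[of "ht \<mu> - ht \<gamma>"] by metis
qed

text \<open>If the total pairs positively with \<alpha> or \<beta>, subtracting that root leaves one
  of the claimed sums. Otherwise \<gamma> pairs negatively with \<alpha> + \<beta>, hence with one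
  of the two.\<close>

lemma sum_of_three:
  assumes a: "\<alpha> \<in> pos" and b: "\<beta> \<in> pos" and c: "\<gamma> \<in> pos"
    and ab: "\<alpha> + \<beta> \<in> R" and abc: "\<alpha> + \<beta> + \<gamma> \<in> R"
  shows "\<alpha> + \<gamma> \<in> R \<or> \<beta> + \<gamma> \<in> R"
proof -
  define \<sigma> where "\<sigma> = \<alpha> + \<beta> + \<gamma>"
  have s: "\<sigma> \<in> R" using abc \<sigma>_def by simp
  consider "\<sigma> \<bullet> \<alpha> > 0" | "\<sigma> \<bullet> \<beta> > 0" | "\<sigma> \<bullet> \<alpha> \<le> 0" "\<sigma> \<bullet> \<beta> \<le> 0" by linarith
  then show ?thesis
  proof cases
    case 1
    have "\<sigma> - \<alpha> = \<beta> + \<gamma>" by (simp add: \<sigma>_def)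
    then show ?thesis
      using root_diff[OF s pos_in_R[OF a] 1] pos_add_neq_0[OF b c] by (metis eq_iff_diff_eq_0)
  next
    case 2
    have "\<sigma> - \<beta> = \<alpha> + \<gamma>" by (simp add: \<sigma>_def)
    then show ?thesis
      using root_diff[OF s pos_in_R[OF b] 2] pos_add_neq_0[OF a c] by (metis eq_iff_diff_eq_0)
  next
    case 3
    then have "\<gamma> \<bullet> (\<alpha> + \<beta>) < 0"
      using inner_pos[OF ab] by (simp add: \<sigma>_def inner_add inner_commute)
    then have "\<alpha> \<bullet> \<gamma> < 0 \<or> \<beta> \<bullet> \<gamma> < 0" by (auto simp: inner_add inner_commute)
    then show ?thesis using pos_root_add a b c pos_in_R by blast
  qed
qed

text \<open>If \<open>\<eta>\<^sub>1\<close>, \<open>\<eta>\<^sub>2\<close> are maximal and \<open>m\<close> is their coefficientwise minimum, then \<open>m \<noteq> 0\<close> and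
  maximality gives \<open>\<eta>\<^sub>1 \<bullet> \<eta>\<^sub>2 \<ge> m \<bullet> m > 0\<close>; hence \<open>\<eta>\<^sub>1 - \<eta>\<^sub>2\<close> is a root or \<open>0\<close>, so the two are comparable.\<close>

lemma maximal_roots_below_unique:
  assumes nu: "\<nu> \<in> P"
    and e1: "\<eta>1 \<in> pos" "\<nu> \<preceq> \<eta>1" "\<eta>1 \<preceq> v" and e2: "\<eta>2 \<in> pos" "\<nu> \<preceq> \<eta>2" "\<eta>2 \<preceq> v"
    and max1: "\<And>\<eta>. \<eta> \<in> pos \<Longrightarrow> \<eta>1 \<preceq> \<eta> \<Longrightarrow> \<eta> \<preceq> v \<Longrightarrow> \<eta> = \<eta>1"
    and max2: "\<And>\<eta>. \<eta> \<in> pos \<Longrightarrow> \<eta>2 \<preceq> \<eta> \<Longrightarrow> \<eta> \<preceq> v \<Longrightarrow> \<eta> = \<eta>2"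
  shows "\<eta>1 = \<eta>2"
proof (rule ccontr)
  assume ne: "\<eta>1 \<noteq> \<eta>2"
  define m where "m = (\<Sum>\<beta>\<in>P. min (cf \<eta>1 \<beta>) (cf \<eta>2 \<beta>) *\<^sub>R \<beta>)"
  define a b where "a = \<eta>1 - m" and "b = \<eta>2 - m"
  have cfm: "cf m \<beta> = min (cf \<eta>1 \<beta>) (cf \<eta>2 \<beta>)" if "\<beta> \<in> P" for \<beta>
    unfolding m_def using cf_comb[OF that] by simp
  \<comment> \<open>A negative pairing would make \<open>x + \<beta>\<close> a larger root, still
    below \<open>v\<close> because \<open>y\<close> leaves room at \<open>\<beta>\<close>.\<close>
  have step: "\<not> x \<bullet> \<beta> < 0"
    if x: "x \<in> pos" "x \<preceq> v" "\<And>\<eta>. \<eta> \<in> pos \<Longrightarrow> x \<preceq> \<eta> \<Longrightarrow> \<eta> \<preceq> v \<Longrightarrow> \<eta> = x"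
      and y: "y \<in> pos" "y \<preceq> v" and bb: "\<beta> \<in> P" "cf x \<beta> < cf y \<beta>" for x y \<beta>
  proof
    assume "x \<bullet> \<beta> < 0"
    then have p: "x + \<beta> \<in> pos" using pos_root_add x P_pos bb by blast
    have i: "cf x \<beta> \<in> \<int>" "cf y \<beta> \<in> \<int>" using cf_root_Ints x y bb pos_in_R by auto
    have "cf v \<beta> - cf y \<beta> \<in> \<nat>" "cf v \<beta> - cf x \<beta> \<in> \<nat>" using x y bb by (auto simp: rprec_iff)
    then have "cf v \<beta> - cf x \<beta> - 1 \<in> \<nat>"
      using bb i by (auto simp: Nats_altdef2 elim!: Ints_cases)
    then have "x + \<beta> \<preceq> v"
      using x(2) bb(1) by (auto simp: rprec_iff cf_simps cf_basis algebra_simps)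
    then have "x + \<beta> = x" using x(3)[OF p] pos_rprec_add[OF P_pos[OF bb(1)]] by blast
    then show False using bb(1) P_in_R zero_notin_R by auto
  qed
  \<comment> \<open>\<open>b\<close> is supported where \<eta>2 exceeds \<eta>1, which is where
    \<open>step\<close> applies to \<eta>1; for \<open>a\<close> the roles are exchanged.\<close>
  have "(\<Sum>\<beta>\<in>P. cf b \<beta> * (\<beta> \<bullet> \<eta>1)) \<ge> 0"
    using step[OF e1(1,3) max1 e2(1,3)]
    by (intro sum_nonneg) (force simp: b_def cf_simps cfm inner_commute min_def)
  then have b_ge: "b \<bullet> \<eta>1 \<ge> 0" by (simp only: inner_expand[symmetric])
  have "(\<Sum>\<beta>\<in>P. cf a \<beta> * (\<beta> \<bullet> \<eta>2)) \<ge> 0"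
    using step[OF e2(1,3) max2 e1(1,3)]
    by (intro sum_nonneg) (force simp: a_def cf_simps cfm inner_commute min_def)
  then have a_ge: "a \<bullet> \<eta>2 \<ge> 0" by (simp only: inner_expand[symmetric])
  \<comment> \<open>\<open>a\<close> and \<open>b\<close> have disjoint supports and nonnegative
    coefficients, and distinct simple roots pair nonpositively.\<close>
  have "(\<Sum>\<beta>\<in>P. \<Sum>\<delta>\<in>P. cf a \<beta> * (cf b \<delta> * (\<delta> \<bullet> \<beta>))) \<le> 0"
  proof (intro sum_nonpos)
    fix \<beta> \<delta> assume bd: "\<beta> \<in> P" "\<delta> \<in> P"
    have ab: "cf a \<beta> \<ge> 0" "cf b \<delta> \<ge> 0" "\<beta> = \<delta> \<Longrightarrow> cf a \<beta> = 0 \<or> cf b \<delta> = 0"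
      using bd by (auto simp: a_def b_def cf_simps cfm min_def)
    show "cf a \<beta> * (cf b \<delta> * (\<delta> \<bullet> \<beta>)) \<le> 0"
    proof (cases "\<beta> = \<delta>")
      case True
      then show ?thesis using ab by auto
    next
      case False
      then show ?thesis
        using ab simple_inner_le_0[OF bd(2,1)] by (simp add: mult_nonneg_nonpos)
    qed
  qed
  then have ab: "a \<bullet> b \<le> 0"
    by (simp only: sum_distrib_left[symmetric] inner_expand[symmetric] inner_commute[of b])
  \<comment> \<open>The simple root \<nu> lies in both supports, hence in that of
    \<open>m\<close>.\<close>
  have "m \<noteq> 0"
  proof -
    have "cf \<eta>1 \<nu> \<ge> 1" "cf \<eta>2 \<nu> \<ge> 1"
      using rprec_cf_le[OF e1(2) nu] rprec_cf_le[OF e2(2) nu] cf_basis[OF nu, of \<nu>] by auto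
    then show ?thesis using cfm[OF nu] cf_zero by auto
  qed
  then have "m \<bullet> m > 0" by simp
  moreover have "\<eta>1 = m + a" "\<eta>2 = m + b" by (auto simp: a_def b_def)
  then have "\<eta>1 \<bullet> \<eta>2 = m \<bullet> m + a \<bullet> \<eta>2 + b \<bullet> \<eta>1 - a \<bullet> b"
    by (simp add: inner_add inner_commute)
  ultimately have "\<eta>1 \<bullet> \<eta>2 > 0" using a_ge b_ge ab by linarith
  then have r: "\<eta>1 - \<eta>2 \<in> R" using root_diff ne e1 e2 pos_in_R by blast
  then have "\<eta>1 - \<eta>2 \<in> pos \<or> \<eta>2 - \<eta>1 \<in> pos" using pos_or_neg[OF r] by simp
  then have "\<eta>2 \<preceq> \<eta>1 \<or> \<eta>1 \<preceq> \<eta>2" by (auto simp: rprec_def pos_roots_def)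
  then show False using max1 max2 e1 e2 ne by blast
qed

section \<open>Common upper bounds among the roots\<close>

lemma ex_ht_max:
  assumes "finite B" "B \<noteq> {}" shows "\<exists>m\<in>B. \<forall>y\<in>B. ht y \<le> ht m"
  using arg_min_if_finite[OF assms, of "\<lambda>x. - ht x"] by force

lemma ex_maximal_above:
  assumes "x \<in> A" "finite A"
  shows "\<exists>m\<in>A. x \<preceq> m \<and> (\<forall>y\<in>A. m \<preceq> y \<longrightarrow> y = m)"
proof -
  let ?B = "{y\<in>A. x \<preceq> y}"
  have "finite ?B" "?B \<noteq> {}" using assms rprec_refl by auto
  from ex_ht_max[OF this] obtain m where m: "m \<in> ?B" "\<forall>y\<in>?B. ht y \<le> ht m" by blast
  have "y = m" if y: "y \<in> A" "m \<preceq> y" for y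
  proof -
    have "x \<preceq> y" using m(1) y(2) rprec_trans by blast
    then have le: "ht y \<le> ht m" using m(2) y(1) by blast
    have nn: "\<And>\<beta>. \<beta> \<in> P \<Longrightarrow> cf y \<beta> - cf m \<beta> \<ge> 0" using rprec_cf_le[OF y(2)] by simp
    have "(\<Sum>\<beta>\<in>P. cf y \<beta> - cf m \<beta>) = ht y - ht m" by (simp add: ht_def sum_subtractf)
    moreover have "(\<Sum>\<beta>\<in>P. cf y \<beta> - cf m \<beta>) \<ge> 0" using nn by (rule sum_nonneg)
    ultimately have "(\<Sum>\<beta>\<in>P. cf y \<beta> - cf m \<beta>) = 0" using le by linarith
    then have "\<forall>\<beta>\<in>P. cf y \<beta> - cf m \<beta> = 0" using sum_nonneg_eq_0_iff[OF finite_P nn] by simp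
    then show ?thesis by (intro cf_eqI) simp
  qed
  then show ?thesis using m by blast
qed

text \<open>The maximal roots above the various elements of \<open>A\<close> all coincide by
  \<open>maximal_roots_below_unique\<close>. The bound \<open>v\<close> need not be a root.\<close>

lemma ex_upper_bound_below:
  assumes nu: "\<nu> \<in> P" and "A \<noteq> {}" and A: "\<And>\<eta>. \<eta> \<in> A \<Longrightarrow> \<eta> \<in> pos \<and> \<nu> \<preceq> \<eta> \<and> \<eta> \<preceq> v"
  shows "\<exists>m\<in>pos. m \<preceq> v \<and> (\<forall>\<eta>\<in>A. \<eta> \<preceq> m)"
proof -
  let ?X = "{\<eta>\<in>pos. \<nu> \<preceq> \<eta> \<and> \<eta> \<preceq> v}"
  have fin: "finite ?X" using finite_R by (auto simp: pos_roots_def)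
  have above: "\<exists>m\<in>?X. \<eta> \<preceq> m \<and> (\<forall>y\<in>?X. m \<preceq> y \<longrightarrow> y = m)" if "\<eta> \<in> A" for \<eta>
    using ex_maximal_above[OF _ fin, of \<eta>] A that by blast
  obtain \<eta>0 where "\<eta>0 \<in> A" using assms(2) by blast
  then obtain m where m: "m \<in> ?X" "\<forall>y\<in>?X. m \<preceq> y \<longrightarrow> y = m" using above by blast
  have "\<eta> \<preceq> m" if e: "\<eta> \<in> A" for \<eta>
  proof -
    obtain m' where m': "m' \<in> ?X" "\<eta> \<preceq> m'" "\<forall>y\<in>?X. m' \<preceq> y \<longrightarrow> y = m'" using above[OF e] by blast
    have "m = m'"
      by (rule maximal_roots_below_unique[OF nu, of m v m']) (use m m' rprec_trans in blast)+
    then show ?thesis using m' by simp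
  qed
  then show ?thesis using m by blast
qed

section \<open>Connectedness of the Dynkin diagram\<close>

lemma cartan_simple_le_minus_1:
  assumes "\<alpha> \<in> P" "\<beta> \<in> P" "\<alpha> \<noteq> \<beta>" "\<alpha> \<bullet> \<beta> \<noteq> 0"
  shows "cartan \<alpha> \<beta> \<le> -1"
proof -
  have "\<alpha> \<bullet> \<beta> < 0" using simple_inner_le_0 assms by (metis order_le_less)
  then have "cartan \<alpha> \<beta> < 0" "cartan \<alpha> \<beta> \<in> \<int>"
    using cartan_neg_iff cartan_Ints assms P_in_R by auto
  then show ?thesis by (auto elim!: Ints_cases)
qed

text \<open>Without such a pair the spans of \<open>A\<close> and \<open>P - A\<close> are
  orthogonal; every root lies in one of them, and this splits \<open>R\<close>.\<close>

lemma simple_roots_connected: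
  assumes irr: "irreducible_rs R" and A: "A \<subseteq> P" "A \<noteq> {}" "A \<noteq> P"
  shows "\<exists>\<alpha>\<in>A. \<exists>\<beta>\<in>P - A. \<alpha> \<bullet> \<beta> \<noteq> 0"
proof (rule ccontr)
  assume "\<not> ?thesis"
  then have orth: "\<And>\<alpha> \<beta>. \<alpha> \<in> A \<Longrightarrow> \<beta> \<in> P - A \<Longrightarrow> \<alpha> \<bullet> \<beta> = 0" by blast
  have span_orth: "x \<bullet> y = 0" if "x \<in> span A" "y \<in> span (P - A)" for x y
  proof -
    have "orthogonal a y" if "a \<in> A" for a
      by (rule orthogonal_to_span[OF \<open>y \<in> span (P - A)\<close>]) (simp add: orthogonal_def orth that)
    then have "orthogonal y x"
      by (intro orthogonal_to_span[OF that(1)]) (simp add: orthogonal_commute)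
    then show ?thesis by (simp add: orthogonal_def inner_commute)
  qed
  have pos_span: "\<gamma> \<in> span A \<union> span (P - A)" if "\<gamma> \<in> pos" for \<gamma>
    using that
  proof (induction rule: pos_induct)
    case (simple \<beta>)
    then show ?case using span_base[of \<beta> A] span_base[of \<beta> "P - A"] by blast
  next
    case (reflect \<gamma> \<beta>)
    have e: "\<gamma> = refl \<beta> \<gamma> + cartan \<gamma> \<beta> *\<^sub>R \<beta>" by (simp add: refl_eq)
    \<comment> \<open>Since \<open>\<beta>\<close> is not orthogonal to the reflected root, it
      belongs to the part whose span contains that root, so \<open>\<gamma>\<close> stays in the
      same span.\<close>
    have "refl \<beta> \<gamma> \<bullet> \<beta> = - (\<gamma> \<bullet> \<beta>)"
      using inner_pos[OF P_in_R[OF reflect(2)]] by (simp add: refl_def inner_diff_left)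
    then have ne: "refl \<beta> \<gamma> \<bullet> \<beta> \<noteq> 0" using reflect(3) by simp
    have step: "\<gamma> \<in> span B" if "refl \<beta> \<gamma> \<in> span B" "\<beta> \<in> B" for B
      using span_add[OF that(1) span_scale[OF span_base[OF that(2)], of "cartan \<gamma> \<beta>"]]
      by (simp only: e[symmetric])
    show ?case
    proof (cases "refl \<beta> \<gamma> \<in> span A")
      case True
      have "\<beta> \<notin> P - A" using span_orth[OF True span_base] ne by blast
      then show ?thesis using step[OF True] reflect(2) by blast
    next
      case False
      then have s: "refl \<beta> \<gamma> \<in> span (P - A)" using reflect(5) by blast
      have "\<beta> \<notin> A" using span_orth[OF span_base s, of \<beta>] ne by (auto simp: inner_commute)
      then show ?thesis using step[OF s] reflect(2) by blast
    qed
  qed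
  have R_span: "R \<subseteq> span A \<union> span (P - A)"
  proof
    fix \<gamma> assume "\<gamma> \<in> R"
    then have "\<gamma> \<in> span A \<union> span (P - A) \<or> - \<gamma> \<in> span A \<union> span (P - A)"
      using pos_or_neg pos_span by blast
    then show "\<gamma> \<in> span A \<union> span (P - A)" using span_neg[of "- \<gamma>"] by auto
  qed
  \<comment> \<open>A vector in both spans is orthogonal to itself.\<close>
  have "x \<notin> R" if "x \<in> span A" "x \<in> span (P - A)" for x
    using span_orth[OF that] zero_notin_R by auto
  then have "(R \<inter> span A) \<inter> (R \<inter> span (P - A)) = {}" by blast
  moreover have "R \<inter> span A \<noteq> {}" "R \<inter> span (P - A) \<noteq> {}"
  proof -
    obtain x y where "x \<in> A" "y \<in> P - A" using A by blast
    then have "x \<in> R \<inter> span A" "y \<in> R \<inter> span (P - A)"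
      using A(1) P_in_R span_base[of x A] span_base[of y "P - A"] by blast+
    then show "R \<inter> span A \<noteq> {}" "R \<inter> span (P - A) \<noteq> {}" by blast+
  qed
  moreover have "(R \<inter> span A) \<union> (R \<inter> span (P - A)) = R" using R_span by blast
  moreover have "\<forall>\<alpha>\<in>R \<inter> span A. \<forall>\<beta>\<in>R \<inter> span (P - A). \<alpha> \<bullet> \<beta> = 0" using span_orth by blast
  ultimately have "\<exists>A B. A \<noteq> {} \<and> B \<noteq> {} \<and> A \<union> B = R \<and> A \<inter> B = {} \<and> (\<forall>\<alpha>\<in>A. \<forall>\<beta>\<in>B. \<alpha> \<bullet> \<beta> = 0)"
    by (rule_tac x = "R \<inter> span A" in exI, rule_tac x = "R \<inter> span (P - A)" in exI, intro conjI)
  then show False using irr unfolding irreducible_rs_def by (elim conjE notE)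
qed

section \<open>The Weyl group\<close>

lemma refl_linear: "linear (refl \<alpha>)"
  by (rule linearI) (simp_all add: refl_def inner_add_left algebra_simps add_divide_distrib scaleR_add_left)

lemma refl_inner: "refl \<alpha> x \<bullet> refl \<alpha> y = x \<bullet> y"
  by (cases "\<alpha> = 0") (simp_all add: refl_def inner_diff inner_commute field_simps power2_eq_square)

lemma refl_refl [simp]: "refl \<alpha> (refl \<alpha> x) = x"
  by (cases "\<alpha> = 0") (simp_all add: refl_def inner_diff_left algebra_simps scaleR_add_left[symmetric])

lemma refl_uminus: "refl (- \<alpha>) = refl \<alpha>"
  by (rule ext) (simp add: refl_def)

lemma weyl_linear: "w \<in> weyl R \<Longrightarrow> linear w"
proof (induction rule: weyl.induct)
  case weyl_id
  then show ?case by (rule linear_id)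
next
  case (weyl_step w \<alpha>)
  then show ?case using linear_compose refl_linear by blast
qed

lemma weyl_inner: "w \<in> weyl R \<Longrightarrow> w x \<bullet> w y = x \<bullet> y"
  by (induction rule: weyl.induct) (auto simp: refl_inner)

lemma weyl_in_R: "w \<in> weyl R \<Longrightarrow> \<gamma> \<in> R \<Longrightarrow> w \<gamma> \<in> R"
  by (induction rule: weyl.induct) (auto simp: refl_in_R)

lemma weyl_comp: "w \<in> weyl R \<Longrightarrow> v \<in> weyl R \<Longrightarrow> w \<circ> v \<in> weyl R"
  by (induction rule: weyl.induct) (auto intro: weyl.intros simp: comp_assoc)

lemma refl_in_weyl: "\<alpha> \<in> R \<Longrightarrow> refl \<alpha> \<in> weyl R"
  using weyl_step[OF weyl_id, of \<alpha>] by simp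

lemma weyl_inverse: "w \<in> weyl R \<Longrightarrow> \<exists>v\<in>weyl R. v \<circ> w = id \<and> w \<circ> v = id"
proof (induction rule: weyl.induct)
  case weyl_id
  then show ?case using weyl.weyl_id by (intro bexI[of _ id]) auto
next
  case (weyl_step w \<alpha>)
  then obtain v where v: "v \<in> weyl R" "v \<circ> w = id" "w \<circ> v = id" by blast
  show ?case
    by (rule bexI[of _ "v \<circ> refl \<alpha>"])
      (use v weyl_step.hyps in \<open>auto simp: fun_eq_iff intro: weyl_comp refl_in_weyl\<close>)
qed

lemma refl_conj:
  assumes "w \<in> weyl R" shows "refl (w \<alpha>) (w x) = w (refl \<alpha> x)"
  using weyl_linear[OF assms] by (simp add: refl_def weyl_inner[OF assms] linear_diff linear_scale)

text \<open>This repeats the \<open>foldr\<close> inside \<open>weyl_length\<close>, so that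
  unfolding identifies the two.\<close>

definition word :: "'a list \<Rightarrow> 'a \<Rightarrow> 'a" where
  "word as = foldr (\<lambda>\<alpha> f. refl \<alpha> \<circ> f) as id"

lemma word_Nil [simp]: "word [] = id" and word_Cons [simp]: "word (a # as) = refl a \<circ> word as"
  by (simp_all add: word_def)

lemma word_append: "word (as @ bs) = word as \<circ> word bs"
  by (induction as) (auto simp: comp_assoc)

lemma word_in_weyl: "set as \<subseteq> P \<Longrightarrow> word as \<in> weyl R"
  by (induction as) (auto intro: weyl.intros P_in_R)

text \<open>Conjugating the reflection in \<open>refl \<beta> \<gamma>\<close> by that in the simple
  root \<open>\<beta>\<close> gives the reflection in \<open>\<gamma>\<close>.\<close>

lemma refl_is_word:
  assumes "\<gamma> \<in> pos" shows "\<exists>as. set as \<subseteq> P \<and> refl \<gamma> = word as"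
  using assms
proof (induction rule: pos_induct)
  case (simple \<beta>)
  then show ?case by (intro exI[of _ "[\<beta>]"]) auto
next
  case (reflect \<gamma> \<beta>)
  then obtain as where as: "set as \<subseteq> P" "refl (refl \<beta> \<gamma>) = word as" by blast
  have "refl \<gamma> x = refl \<beta> (refl (refl \<beta> \<gamma>) (refl \<beta> x))" for x
    using refl_conj[OF refl_in_weyl[OF P_in_R[OF reflect(2)]], of "refl \<beta> \<gamma>" "refl \<beta> x"] by simp
  then have "refl \<gamma> = word (\<beta> # as @ [\<beta>])"
    by (auto simp: word_append as(2)[symmetric] fun_eq_iff)
  then show ?case using as reflect by (intro exI[of _ "\<beta> # as @ [\<beta>]"]) auto
qed

text \<open>\<open>weyl\<close> is generated by all reflections but \<open>weyl_length\<close>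
  counts simple ones; this guarantees that the least length is attained.\<close>

lemma weyl_is_word: "w \<in> weyl R \<Longrightarrow> \<exists>as. set as \<subseteq> P \<and> w = word as"
proof (induction rule: weyl.induct)
  case weyl_id
  then show ?case by (intro exI[of _ "[]"]) auto
next
  case (weyl_step w \<alpha>)
  then obtain as where as: "set as \<subseteq> P" "w = word as" by blast
  have "\<exists>bs. set bs \<subseteq> P \<and> refl \<alpha> = word bs"
    using pos_or_neg[OF weyl_step(2)] refl_is_word[of \<alpha>] refl_is_word[of "- \<alpha>"] refl_uminus[of \<alpha>]
    by auto
  then obtain bs where "set bs \<subseteq> P" "refl \<alpha> = word bs" by blast
  then show ?case using as by (intro exI[of _ "bs @ as"]) (auto simp: word_append)
qed

lemma weyl_length_word: "set as \<subseteq> P \<Longrightarrow> weyl_length P (word as) \<le> length as"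
  unfolding weyl_length_def word_def by (rule Least_le) blast

lemma ex_reduced_word:
  assumes "w \<in> weyl R"
  shows "\<exists>as. set as \<subseteq> P \<and> w = word as \<and> length as = weyl_length P w"
proof -
  obtain as where "set as \<subseteq> P" "w = word as" using weyl_is_word[OF assms] by blast
  then have "\<exists>k as. length as = k \<and> set as \<subseteq> P \<and> w = foldr (\<lambda>\<alpha> f. refl \<alpha> \<circ> f) as id"
    by (auto simp: word_def)
  from LeastI_ex[OF this] show ?thesis unfolding weyl_length_def word_def by blast
qed

text \<open>Reading from the right, some letter \<open>a\<close> turns the image of
  \<open>\<beta>\<close> from positive to non-positive. That image is then \<open>a\<close> itself,
  and deleting the letter amounts to multiplying by \<open>refl \<beta>\<close> on the
  right.\<close>

lemma exchange:
  assumes "set as \<subseteq> P" "\<beta> \<in> P" "word as \<beta> \<notin> pos"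
  shows "\<exists>bs. set bs \<subseteq> P \<and> length bs < length as \<and> word bs = word as \<circ> refl \<beta>"
  using assms
proof (induction as)
  case Nil
  then show ?case using P_pos by auto
next
  case (Cons a as)
  show ?case
  proof (cases "word as \<beta> \<in> pos")
    case True
    have w: "word as \<in> weyl R" using word_in_weyl Cons.prems by auto
    have "word as \<beta> = a" using refl_simple_pos[of a, OF _ True] Cons.prems by auto
    then have "refl a \<circ> word as \<circ> refl \<beta> = word as"
      using refl_conj[OF w, of \<beta>] by (auto simp: fun_eq_iff)
    then have "word as = word (a # as) \<circ> refl \<beta>" by simp
    moreover have "set as \<subseteq> P" using Cons.prems by simp
    ultimately show ?thesis by (metis length_Cons lessI)
  next
    case False
    then obtain bs where bs: "set bs \<subseteq> P" "length bs < length as" "word bs = word as \<circ> refl \<beta>"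
      using Cons.IH[OF _ _ False] Cons.prems by (metis insert_subset list.simps(15))
    then have "word (a # bs) = word (a # as) \<circ> refl \<beta>" by (simp add: comp_assoc)
    moreover have "set (a # bs) \<subseteq> P" using Cons.prems(1) bs(1) by simp
    moreover have "length (a # bs) < length (a # as)" using bs(2) by simp
    ultimately show ?thesis by blast
  qed
qed

lemma weyl_length_refl_less:
  assumes w: "w \<in> weyl R" and b: "\<beta> \<in> P" and neg: "w \<beta> \<notin> pos"
  shows "weyl_length P (w \<circ> refl \<beta>) < weyl_length P w"
proof -
  obtain as where as: "set as \<subseteq> P" "w = word as" "length as = weyl_length P w"
    using ex_reduced_word[OF w] by blast
  then obtain bs where "set bs \<subseteq> P" "length bs < length as" "word bs = w \<circ> refl \<beta>"
    using exchange[of as \<beta>] b neg by auto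
  then show ?thesis using weyl_length_word[of bs] as by simp
qed

text \<open>If a reduced word of \<open>w\<close> ended in \<open>\<beta>\<close>, the prefix would
  send \<open>\<beta>\<close> to a negative root. Then \<open>w\<close> would be shorter than its
  own prefix.\<close>

lemma weyl_pos_eq_id:
  assumes w: "w \<in> weyl R" and p: "\<And>\<beta>. \<beta> \<in> P \<Longrightarrow> w \<beta> \<in> pos"
  shows "w = id"
proof -
  obtain as where as: "set as \<subseteq> P" "w = word as" "length as = weyl_length P w"
    using ex_reduced_word[OF w] by blast
  show ?thesis
  proof (cases as rule: rev_cases)
    case Nil
    then show ?thesis using as by simp
  next
    case (snoc bs \<beta>)
    have b: "\<beta> \<in> P" and bs: "set bs \<subseteq> P" using snoc as by auto
    have wb: "word bs \<in> weyl R" using word_in_weyl bs by blast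
    have e: "word bs \<circ> refl \<beta> = w" using snoc as by (simp add: word_append)
    have "refl \<beta> \<beta> = - \<beta>" using cartan_self[OF P_in_R[OF b]] by (simp add: refl_eq scaleR_2)
    then have "w \<beta> = - word bs \<beta>"
      using e[symmetric] linear_neg[OF weyl_linear[OF wb]] by simp
    then have "word bs \<beta> \<notin> pos" using p[OF b] pos_not_neg by (metis)
    from weyl_length_refl_less[OF wb b this] show ?thesis
      using weyl_length_word[OF bs] as snoc e by simp
  qed
qed

end

locale highest_root_system = based_root_system +
  fixes \<theta> :: 'a
  assumes highest: "highest_root R P \<theta>" and long_exists: "simple_long_roots R P \<noteq> {}"
begin

section \<open>The highest root and its Weyl group orbit\<close>

lemma theta_pos: "\<theta> \<in> pos" and rprec_theta: "\<gamma> \<in> pos \<Longrightarrow> \<gamma> \<preceq> \<theta>"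
  using highest by (auto simp: highest_root_def)

lemma theta_in_R: "\<theta> \<in> R"
  using theta_pos pos_in_R by blast

lemma theta_dominant_simple: "\<beta> \<in> P \<Longrightarrow> \<theta> \<bullet> \<beta> \<ge> 0"
proof (rule ccontr)
  assume b: "\<beta> \<in> P" and "\<not> \<theta> \<bullet> \<beta> \<ge> 0"
  then have "\<theta> + \<beta> \<in> pos" using pos_root_add theta_pos P_pos by auto
  then have "\<theta> + \<beta> \<preceq> \<theta>" by (rule rprec_theta)
  then have "\<theta> + \<beta> = \<theta>" using pos_rprec_add[OF P_pos[OF b]] rprec_antisym by blast
  then show False using b P_in_R zero_notin_R by auto
qed

lemma theta_dominant: "\<gamma> \<in> pos \<Longrightarrow> \<gamma> \<bullet> \<theta> \<ge> 0"
  by (subst inner_expand, subst inner_commute)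
    (intro sum_nonneg mult_nonneg_nonneg pos_cf_nonneg theta_dominant_simple; assumption)

text \<open>\<open>\<theta> - \<mu>\<close> is a nonnegative combination and \<open>\<mu>\<close> is
  dominant, so \<open>\<theta> \<bullet> \<mu> \<ge> \<mu> \<bullet> \<mu>\<close>; with the length
  assumption \<open>\<theta> - \<mu>\<close> has norm 0.\<close>

lemma dominant_long_eq_theta:
  assumes m: "\<mu> \<in> R" "\<theta> \<bullet> \<theta> \<le> \<mu> \<bullet> \<mu>" and dom: "\<And>\<beta>. \<beta> \<in> P \<Longrightarrow> \<mu> \<bullet> \<beta> \<ge> 0"
  shows "\<mu> = \<theta>"
proof -
  have comb: "x \<bullet> \<mu> \<ge> 0" if "\<And>\<beta>. \<beta> \<in> P \<Longrightarrow> cf x \<beta> \<ge> 0" for x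
    by (subst inner_expand, subst inner_commute) (intro sum_nonneg mult_nonneg_nonneg that dom; assumption)
  have "\<mu> \<in> pos"
  proof (rule ccontr)
    assume "\<mu> \<notin> pos"
    then have "- \<mu> \<in> pos" using pos_or_neg m by blast
    then have "(- \<mu>) \<bullet> \<mu> \<ge> 0" by (intro comb pos_cf_nonneg)
    then show False using inner_pos[OF m(1)] by simp
  qed
  then have "(\<theta> - \<mu>) \<bullet> \<mu> \<ge> 0"
    using rprec_cf_le[OF rprec_theta] by (intro comb) (simp add: cf_diff)
  then have "(\<theta> - \<mu>) \<bullet> (\<theta> - \<mu>) \<le> 0" using m(2) by (simp add: inner_diff inner_commute)
  then show ?thesis by (metis eq_iff_diff_eq_0 inner_eq_zero_iff inner_ge_zero order_antisym)
qed

text \<open>An element of greatest height in the orbit of \<open>\<alpha>\<close> is dominant, since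
  reflecting in a simple root with negative pairing would raise it; hence it is
  \<open>\<theta>\<close>.\<close>

lemma long_conjugate_theta:
  assumes "\<alpha> \<in> long_roots R"
  shows "\<exists>w\<in>weyl R. w \<theta> = \<alpha>"
proof -
  have a: "\<alpha> \<in> R" "\<theta> \<bullet> \<theta> \<le> \<alpha> \<bullet> \<alpha>" using assms theta_in_R by (auto simp: long_roots_def)
  let ?O = "{w \<alpha> |w. w \<in> weyl R}"
  have "?O \<subseteq> R" using weyl_in_R a by auto
  then have "finite ?O" using finite_R finite_subset by blast
  moreover have "?O \<noteq> {}" using weyl_id by blast
  ultimately obtain \<mu> where m: "\<mu> \<in> ?O" "\<forall>y\<in>?O. ht y \<le> ht \<mu>" using ex_ht_max by blast
  then obtain w where w: "w \<in> weyl R" "\<mu> = w \<alpha>" by blast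
  have "\<mu> \<bullet> \<beta> \<ge> 0" if b: "\<beta> \<in> P" for \<beta>
  proof (rule ccontr)
    assume "\<not> \<mu> \<bullet> \<beta> \<ge> 0"
    then have neg: "cartan \<mu> \<beta> < 0" using cartan_neg_iff b P_in_R by simp
    have "refl \<beta> \<mu> = (refl \<beta> \<circ> w) \<alpha>" using w by simp
    then have "refl \<beta> \<mu> \<in> ?O" using weyl_step[OF w(1)] b P_in_R by blast
    then have "ht (refl \<beta> \<mu>) \<le> ht \<mu>" using m(2) by blast
    then show False using neg b by (simp add: refl_eq ht_diff ht_scale ht_simple)
  qed
  then have "w \<alpha> = \<theta>"
    using dominant_long_eq_theta[of \<mu>] w a weyl_in_R by (simp add: weyl_inner)
  moreover obtain v where "v \<in> weyl R" "v \<circ> w = id" using weyl_inverse[OF w(1)] by blast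
  ultimately show ?thesis by (metis comp_apply id_apply)
qed

lemma theta_long: "\<theta> \<in> long_roots R"
proof -
  obtain \<alpha> where "\<alpha> \<in> long_roots R"
    using long_exists by (auto simp: simple_long_roots_def pos_long_roots_def)
  moreover from this obtain w where "w \<in> weyl R" "w \<theta> = \<alpha>" using long_conjugate_theta by blast
  ultimately show ?thesis
    using weyl_inner[of w \<theta> \<theta>] theta_in_R by (auto simp: long_roots_def)
qed

section \<open>Minimal-length representatives modulo the stabilizer of \<theta>\<close>

lemma perp_theta_support:
  assumes g: "\<gamma> \<in> pos" "\<gamma> \<bullet> \<theta> = 0" and b: "\<beta> \<in> P" "cf \<gamma> \<beta> \<noteq> 0"
  shows "\<beta> \<bullet> \<theta> = 0"
proof -
  have "(\<Sum>\<beta>\<in>P. cf \<gamma> \<beta> * (\<beta> \<bullet> \<theta>)) = 0" using g inner_expand by metis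
  then have "\<forall>\<beta>\<in>P. cf \<gamma> \<beta> * (\<beta> \<bullet> \<theta>) = 0"
    by (subst (asm) sum_nonneg_eq_0_iff)
      (auto intro!: mult_nonneg_nonneg pos_cf_nonneg g theta_dominant P_pos finite_P)
  then show ?thesis using b by auto
qed

definition min_rep :: "('a \<Rightarrow> 'a) \<Rightarrow> bool" where
  "min_rep w \<longleftrightarrow> w \<in> weyl R \<and> (\<forall>w'\<in>weyl R. w' \<theta> = w \<theta> \<longrightarrow> weyl_length P w \<le> weyl_length P w')"

text \<open>If a simple root orthogonal to \<open>\<theta>\<close> became negative, composing
  \<open>w\<close> with its reflection would shorten \<open>w\<close> without changing
  \<open>w \<theta>\<close>. Other positive roots orthogonal to \<open>\<theta>\<close> are
  combinations of such simple roots.\<close>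

lemma min_rep_pos:
  assumes m: "min_rep w" and g: "\<gamma> \<in> pos" "\<gamma> \<bullet> \<theta> = 0"
  shows "w \<gamma> \<in> pos"
proof -
  have w: "w \<in> weyl R" using m by (simp add: min_rep_def)
  have simple: "w \<beta> \<in> pos" if b: "\<beta> \<in> P" "\<beta> \<bullet> \<theta> = 0" for \<beta>
  proof (rule ccontr)
    assume "w \<beta> \<notin> pos"
    then have "weyl_length P (w \<circ> refl \<beta>) < weyl_length P w"
      using weyl_length_refl_less[OF w b(1)] by blast
    moreover have "(w \<circ> refl \<beta>) \<theta> = w \<theta>"
      using b by (simp add: refl_def inner_commute)
    moreover have "w \<circ> refl \<beta> \<in> weyl R" using w b P_in_R by (auto intro: weyl_comp refl_in_weyl)
    ultimately show False using m unfolding min_rep_def by (metis linorder_not_le)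
  qed
  have "w \<gamma> = w (\<Sum>\<beta>\<in>P. cf \<gamma> \<beta> *\<^sub>R \<beta>)" using cf_expand by metis
  also have "\<dots> = (\<Sum>\<beta>\<in>P. cf \<gamma> \<beta> *\<^sub>R w \<beta>)"
    using weyl_linear[OF w] by (simp add: linear_sum linear_scale)
  finally have e: "w \<gamma> = (\<Sum>\<beta>\<in>P. cf \<gamma> \<beta> *\<^sub>R w \<beta>)" .
  have "cf (w \<gamma>) \<delta> \<ge> 0" if d: "\<delta> \<in> P" for \<delta>
  proof -
    have "(\<Sum>\<beta>\<in>P. cf \<gamma> \<beta> * cf (w \<beta>) \<delta>) \<ge> 0"
    proof (rule sum_nonneg)
      fix \<beta> assume b: "\<beta> \<in> P"
      show "cf \<gamma> \<beta> * cf (w \<beta>) \<delta> \<ge> 0"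
        using simple[OF b] perp_theta_support[OF g b] pos_cf_nonneg[OF _ d] pos_cf_nonneg[OF g(1) b]
        by (cases "cf \<gamma> \<beta> = 0") auto
    qed
    then show ?thesis by (simp only: e cf_sum cf_scale)
  qed
  then show ?thesis using weyl_in_R[OF w] g pos_in_R by (auto simp: pos_iff)
qed

text \<open>The inverse of \<open>w\<close> followed after \<open>w'\<close> fixes
  \<open>\<theta>\<close>. It preserves positivity of simple roots: one made negative would be
  orthogonal to \<open>\<theta>\<close>, and \<open>min_rep_pos\<close> for \<open>w\<close> and
  \<open>w'\<close> would give opposite signs to its image under \<open>w'\<close>. So it is the
  identity.\<close>

lemma min_rep_unique:
  assumes m: "min_rep w" "min_rep w'" and e: "w \<theta> = w' \<theta>"
  shows "w = w'"
proof -
  have w: "w \<in> weyl R" "w' \<in> weyl R" using m by (auto simp: min_rep_def)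
  obtain v where v: "v \<in> weyl R" "v \<circ> w = id" "w \<circ> v = id" using weyl_inverse[OF w(1)] by blast
  have wv: "w (v x) = x" and vw: "v (w x) = x" for x using v by (metis comp_apply id_apply)+
  let ?u = "v \<circ> w'"
  have u: "?u \<in> weyl R" using weyl_comp v w by blast
  have ut: "?u \<theta> = \<theta>" using e[symmetric] vw by simp
  have "?u \<beta> \<in> pos" if b: "\<beta> \<in> P" for \<beta>
  proof (rule ccontr)
    assume "?u \<beta> \<notin> pos"
    then have n: "- ?u \<beta> \<in> pos" using pos_or_neg weyl_in_R[OF u] b P_in_R by blast
    have i: "?u \<beta> \<bullet> \<theta> = \<beta> \<bullet> \<theta>" using weyl_inner[OF u, of \<beta> \<theta>] ut by simp
    then have z: "\<beta> \<bullet> \<theta> = 0"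
      using theta_dominant[OF n] theta_dominant[OF P_pos[OF b]] by simp
    then have "w (- ?u \<beta>) \<in> pos" using min_rep_pos[OF m(1) n] i by simp
    then have "- w' \<beta> \<in> pos" using linear_neg[OF weyl_linear[OF w(1)]] wv by simp
    moreover have "w' \<beta> \<in> pos" using min_rep_pos[OF m(2) P_pos[OF b] z] .
    ultimately show False using pos_not_neg by blast
  qed
  then have "?u = id" using weyl_pos_eq_id u by blast
  then have "\<And>x. v (w' x) = x" by (metis comp_apply id_apply)
  then have "w (v (w' x)) = w x" for x by simp
  then show ?thesis using wv by (auto simp: fun_eq_iff)
qed

text \<open>Existence by conjugacy and uniqueness by \<open>min_rep_unique\<close> make the
  \<open>THE\<close> in \<open>w_of\<close> meaningful.\<close>

lemma w_of_min_rep: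
  assumes "\<alpha> \<in> long_roots R"
  shows "min_rep (w_of R P \<theta> \<alpha>)" "w_of R P \<theta> \<alpha> \<theta> = \<alpha>"
proof -
  let ?Q = "\<lambda>w. w \<in> weyl R \<and> w \<theta> = \<alpha> \<and>
      (\<forall>w'\<in>weyl R. w' \<theta> = \<alpha> \<longrightarrow> weyl_length P w \<le> weyl_length P w')"
  have iff: "?Q w \<longleftrightarrow> min_rep w \<and> w \<theta> = \<alpha>" for w
    by (auto simp: min_rep_def)
  obtain w where "w \<in> weyl R" "w \<theta> = \<alpha>" using long_conjugate_theta[OF assms] by blast
  then have "\<exists>w. ?Q w"
    using ex_has_least_nat[of "\<lambda>w. w \<in> weyl R \<and> w \<theta> = \<alpha>" w "weyl_length P"] by blast
  moreover have "\<And>w w'. ?Q w \<Longrightarrow> ?Q w' \<Longrightarrow> w = w'"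
    using min_rep_unique iff by metis
  ultimately have "\<exists>!w. ?Q w" by blast
  from theI'[OF this] have "?Q (w_of R P \<theta> \<alpha>)" unfolding w_of_def .
  then show "min_rep (w_of R P \<theta> \<alpha>)" "w_of R P \<theta> \<alpha> \<theta> = \<alpha>" using iff by blast+
qed

section \<open>Minimal and maximal abelian ideals\<close>

abbreviation H :: "'a set" where "H \<equiv> H_set R P \<theta>"

section \<open>Positive roots not orthogonal to \<theta>\<close>

lemma H_iff: "\<gamma> \<in> H \<longleftrightarrow> \<gamma> \<in> pos \<and> \<gamma> \<bullet> \<theta> > 0"
  by (simp add: H_set_def)

lemma theta_in_H: "\<theta> \<in> H"
  using theta_pos inner_pos[OF theta_in_R] by (simp add: H_iff)

lemma cartan_theta_H: "\<gamma> \<in> H \<Longrightarrow> cartan \<gamma> \<theta> \<ge> 1"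
proof -
  assume "\<gamma> \<in> H"
  then have "cartan \<gamma> \<theta> > 0" "cartan \<gamma> \<theta> \<in> \<int>"
    using cartan_pos_iff cartan_Ints theta_in_R pos_in_R by (auto simp: H_iff)
  then show ?thesis by (auto elim!: Ints_cases)
qed

text \<open>As \<open>\<theta>\<close> is long, \<open>\<theta> - \<gamma>\<close> having positive
  norm forces the integral pairing to be below 2.\<close>

lemma cartan_theta_le_1: "\<gamma> \<in> R \<Longrightarrow> \<gamma> \<noteq> \<theta> \<Longrightarrow> cartan \<gamma> \<theta> \<le> 1"
proof -
  assume g: "\<gamma> \<in> R" and ne: "\<gamma> \<noteq> \<theta>"
  have "(\<theta> - \<gamma>) \<bullet> (\<theta> - \<gamma>) > 0" using ne by simp
  moreover have "\<gamma> \<bullet> \<gamma> \<le> \<theta> \<bullet> \<theta>" using theta_long g by (auto simp: long_roots_def)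
  ultimately have "2 * (\<gamma> \<bullet> \<theta>) < 2 * (\<theta> \<bullet> \<theta>)"
    by (simp only: inner_diff_left inner_diff_right inner_commute[of \<theta> \<gamma>])
  then have "cartan \<gamma> \<theta> < 2"
    unfolding cartan_def using inner_pos[OF theta_in_R] by (simp only: pos_divide_less_eq)
  moreover have "cartan \<gamma> \<theta> \<in> \<int>" using cartan_Ints theta_in_R g by blast
  ultimately show ?thesis by (auto elim!: Ints_cases)
qed

lemma cartan_add: "cartan (x + y) z = cartan x z + cartan y z"
  by (simp add: cartan_def inner_add_left add_divide_distrib distrib_left)

lemma H_cartan: "\<gamma> \<in> H \<Longrightarrow> \<gamma> \<noteq> \<theta> \<Longrightarrow> cartan \<gamma> \<theta> = 1"
  using cartan_theta_H[of \<gamma>] cartan_theta_le_1[of \<gamma>] pos_in_R[of \<gamma>] by (auto simp: H_iff)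

lemma H_iff_cartan: "\<gamma> \<in> H \<longleftrightarrow> \<gamma> \<in> pos \<and> cartan \<gamma> \<theta> > 0"
  using cartan_pos_iff theta_in_R by (simp add: H_iff)

lemma theta_plus_notin_R: "\<gamma> \<in> pos \<Longrightarrow> \<theta> + \<gamma> \<notin> R"
proof
  assume g: "\<gamma> \<in> pos" and "\<theta> + \<gamma> \<in> R"
  then have "\<theta> + \<gamma> \<preceq> \<theta>" using pos_add theta_pos rprec_theta by blast
  then have "\<theta> + \<gamma> = \<theta>" using pos_rprec_add[OF g] rprec_antisym by blast
  then show False using g pos_in_R zero_notin_R by auto
qed

lemma theta_minus_H: "\<gamma> \<in> H \<Longrightarrow> \<gamma> \<noteq> \<theta> \<Longrightarrow> \<theta> - \<gamma> \<in> H"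
proof -
  assume g: "\<gamma> \<in> H" "\<gamma> \<noteq> \<theta>"
  then have c: "cartan \<gamma> \<theta> = 1" by (rule H_cartan)
  have gR: "\<gamma> \<in> R" using g pos_in_R by (auto simp: H_iff)
  \<comment> \<open>With pairing 1, \<open>\<theta> - \<gamma>\<close> is the negative of the
    reflection of \<open>\<gamma>\<close> in \<open>\<theta>\<close>.\<close>
  have "\<theta> - \<gamma> \<in> R"
    using uminus_in_R[OF refl_in_R[OF theta_in_R gR]] c by (simp add: refl_eq)
  then have p: "\<theta> - \<gamma> \<in> pos"
    using rprec_theta[of \<gamma>] g by (auto simp: pos_roots_def rprec_def H_iff)
  have "cartan (\<theta> - \<gamma>) \<theta> = 1"
    using cartan_add[of "\<theta> - \<gamma>" \<gamma> \<theta>] c cartan_self[OF theta_in_R] by simp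
  then show ?thesis using p by (simp add: H_iff_cartan)
qed

lemma H_upper: "\<gamma> \<in> H \<Longrightarrow> \<nu> \<in> pos \<Longrightarrow> \<nu> + \<gamma> \<in> pos \<Longrightarrow> \<nu> + \<gamma> \<in> H"
  using theta_dominant[of \<nu>] by (simp add: H_iff inner_add_left)

text \<open>The sum has pairing at least 2 with the coroot of \<open>\<theta>\<close>, and only
  \<open>\<theta>\<close> itself reaches that among the roots.\<close>

lemma H_add_eq_theta: "\<gamma> \<in> H \<Longrightarrow> \<nu> \<in> H \<Longrightarrow> \<gamma> + \<nu> \<in> R \<Longrightarrow> \<gamma> + \<nu> = \<theta>"
  using cartan_theta_H[of \<gamma>] cartan_theta_H[of \<nu>] cartan_theta_le_1[of "\<gamma> + \<nu>"] cartan_add[of \<gamma> \<nu> \<theta>]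
  by force

text \<open>Climb from the sum to \<open>\<theta>\<close> by simple roots. At each step
  \<open>sum_of_three\<close> lets one of the two summands absorb the new simple root.\<close>

lemma sum_raise_to_theta:
  assumes "\<gamma> \<in> pos" "\<eta> \<in> pos" "\<gamma> + \<eta> \<in> R"
  shows "\<exists>\<gamma>'\<in>pos. \<exists>\<eta>'\<in>pos. \<gamma> \<preceq> \<gamma>' \<and> \<eta> \<preceq> \<eta>' \<and> \<gamma>' + \<eta>' = \<theta>"
proof -
  have "\<gamma> \<in> pos \<Longrightarrow> \<eta> \<in> pos \<Longrightarrow> \<gamma> + \<eta> \<in> R \<Longrightarrow> ht \<theta> - ht (\<gamma> + \<eta>) < real n \<Longrightarrow>
    \<exists>\<gamma>'\<in>pos. \<exists>\<eta>'\<in>pos. \<gamma> \<preceq> \<gamma>' \<and> \<eta> \<preceq> \<eta>' \<and> \<gamma>' + \<eta>' = \<theta>" for n \<gamma> \<eta>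
  proof (induction n arbitrary: \<gamma> \<eta>)
    case 0
    have "\<gamma> + \<eta> \<preceq> \<theta>" using 0 pos_add rprec_theta by blast
    then have "ht (\<gamma> + \<eta>) \<le> ht \<theta>" unfolding ht_def by (intro sum_mono rprec_cf_le)
    then show ?case using 0 by simp
  next
    case (Suc n)
    have s: "\<gamma> + \<eta> \<in> pos" using Suc.prems pos_add by blast
    show ?case
    proof (cases "\<gamma> + \<eta> = \<theta>")
      case True
      then show ?thesis using Suc.prems rprec_refl by blast
    next
      case False
      obtain \<beta> where b: "\<beta> \<in> P" "\<gamma> + \<eta> + \<beta> \<in> pos"
        using rprec_step[OF s theta_pos rprec_theta[OF s] False] by blast
      have bp: "\<beta> \<in> pos" using b P_pos by blast
      have e: "\<gamma> + \<beta> + \<eta> = \<gamma> + \<eta> + \<beta>" "\<gamma> + (\<eta> + \<beta>) = \<gamma> + \<eta> + \<beta>" by (simp_all add: algebra_simps)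
      have h: "ht \<theta> - ht (\<gamma> + \<eta> + \<beta>) < real n"
        using Suc.prems(4) b by (simp add: ht_add ht_simple)
      consider "\<gamma> + \<beta> \<in> R" | "\<eta> + \<beta> \<in> R"
        using sum_of_three[OF Suc.prems(1,2) bp Suc.prems(3) pos_in_R[OF b(2)]] by blast
      then show ?thesis
      proof cases
        case 1
        then have "\<gamma> + \<beta> \<in> pos" using pos_add Suc.prems bp by blast
        then obtain \<gamma>' \<eta>' where "\<gamma>' \<in> pos" "\<eta>' \<in> pos" "\<gamma> + \<beta> \<preceq> \<gamma>'" "\<eta> \<preceq> \<eta>'" "\<gamma>' + \<eta>' = \<theta>"
          using Suc.IH[of "\<gamma> + \<beta>" \<eta>] Suc.prems(2) pos_in_R[OF b(2)] h unfolding e by blast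
        then show ?thesis using pos_rprec_add[OF bp] rprec_trans by blast
      next
        case 2
        then have "\<eta> + \<beta> \<in> pos" using pos_add Suc.prems bp by blast
        then obtain \<gamma>' \<eta>' where "\<gamma>' \<in> pos" "\<eta>' \<in> pos" "\<gamma> \<preceq> \<gamma>'" "\<eta> + \<beta> \<preceq> \<eta>'" "\<gamma>' + \<eta>' = \<theta>"
          using Suc.IH[of \<gamma> "\<eta> + \<beta>"] Suc.prems(1) pos_in_R[OF b(2)] h unfolding e by blast
        then show ?thesis using pos_rprec_add[OF bp] rprec_trans by blast
      qed
    qed
  qed
  from this[OF assms] show ?thesis using reals_Archimedean2 by blast
qed

text \<open>An explicit set, identified below with \<open>I_max\<close> for long simple
  roots.\<close>

definition centralizer :: "'a \<Rightarrow> 'a set" where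
  "centralizer \<mu> = {\<gamma>\<in>pos. \<forall>\<eta>\<in>I_min R P \<theta> \<mu>. \<gamma> + \<eta> \<notin> R}"

section \<open>The two ideals attached to a fixed long simple root\<close>

context
  fixes \<alpha> :: 'a
  assumes alpha: "\<alpha> \<in> simple_long_roots R P"
begin

abbreviation "w \<equiv> w_of R P \<theta> \<alpha>"

abbreviation "Imin \<equiv> I_min R P \<theta> \<alpha>"

lemma alpha_simple: "\<alpha> \<in> P" and alpha_long: "\<alpha> \<in> long_roots R"
  using alpha by (auto simp: simple_long_roots_def pos_long_roots_def)

lemma w_weyl: "w \<in> weyl R" and w_theta: "w \<theta> = \<alpha>"
  and w_perp: "\<gamma> \<in> pos \<Longrightarrow> \<gamma> \<bullet> \<theta> = 0 \<Longrightarrow> w \<gamma> \<in> pos"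
  using w_of_min_rep[OF alpha_long] min_rep_pos by (auto simp: min_rep_def)

lemma w_theta_minus: "w (\<theta> - \<gamma>) = \<alpha> - w \<gamma>"
  using linear_diff[OF weyl_linear[OF w_weyl]] w_theta by simp

text \<open>The roots \<open>w \<gamma>\<close> and \<open>w (\<theta> - \<gamma>)\<close> add up to the simple root \<open>\<alpha>\<close>, so exactly one of them is
  positive.\<close>

lemma w_theta_minus_pos_iff:
  assumes "\<gamma> \<in> H" "\<gamma> \<noteq> \<theta>"
  shows "w (\<theta> - \<gamma>) \<in> pos \<longleftrightarrow> w \<gamma> \<notin> pos"
proof -
  have R: "w \<gamma> \<in> R" "w (\<theta> - \<gamma>) \<in> R"
    using weyl_in_R[OF w_weyl] theta_minus_H[OF assms] assms pos_in_R by (auto simp: H_iff)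
  have s: "w (\<theta> - \<gamma>) + w \<gamma> = \<alpha>" by (simp add: w_theta_minus)
  have "\<not> (w (\<theta> - \<gamma>) \<in> pos \<and> w \<gamma> \<in> pos)"
    using pos_add_notin_P alpha_simple s by metis
  moreover have "w (\<theta> - \<gamma>) \<in> pos \<or> w \<gamma> \<in> pos"
  proof (rule ccontr)
    assume "\<not> ?thesis"
    then have "- w (\<theta> - \<gamma>) \<in> pos" "- w \<gamma> \<in> pos" using pos_or_neg R by auto
    moreover have "- w (\<theta> - \<gamma>) + - w \<gamma> = - \<alpha>"
      using s by (metis minus_add_distrib)
    moreover have "- \<alpha> \<in> R" using alpha_simple P_in_R uminus_in_R by blast
    ultimately have "- \<alpha> \<in> pos" using pos_add by metis
    then show False using pos_not_neg P_pos alpha_simple by blast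
  qed
  ultimately show ?thesis by blast
qed

text \<open>By \<open>w_perp\<close> an inversion of \<open>w\<close> is never orthogonal to
  \<open>\<theta>\<close>, so it lies in \<open>H\<close>. Passing to
  \<open>\<theta> - \<gamma>\<close> then exchanges inversions with elements of \<open>H\<close>,
  other than \<open>\<theta>\<close>, that \<open>w\<close> keeps positive.\<close>

lemma I_min_iff: "\<eta> \<in> Imin \<longleftrightarrow> \<eta> \<in> H \<and> w \<eta> \<in> pos"
proof
  assume "\<eta> \<in> Imin"
  then consider "\<eta> = \<theta>" | \<gamma> where "\<eta> = \<theta> - \<gamma>" "\<gamma> \<in> pos" "w \<gamma> \<in> uminus ` pos"
    by (auto simp: I_min_def inv_set_def)
  then show "\<eta> \<in> H \<and> w \<eta> \<in> pos"
  proof cases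
    case 1
    then show ?thesis using theta_in_H w_theta P_pos alpha_simple by simp
  next
    case 2
    then have np: "w \<gamma> \<notin> pos" using pos_not_neg by auto
    then have "\<gamma> \<noteq> \<theta>" using w_theta P_pos alpha_simple by auto
    moreover have "\<gamma> \<bullet> \<theta> \<noteq> 0" using np w_perp 2 by blast
    then have "\<gamma> \<in> H" using theta_dominant[OF 2(2)] 2 by (simp add: H_iff)
    ultimately show ?thesis using theta_minus_H w_theta_minus_pos_iff np 2 by blast
  qed
next
  assume a: "\<eta> \<in> H \<and> w \<eta> \<in> pos"
  show "\<eta> \<in> Imin"
  proof (cases "\<eta> = \<theta>")
    case False
    have h: "\<theta> - \<eta> \<in> H" using theta_minus_H a False by blast
    have "w (\<theta> - \<eta>) \<notin> pos" using w_theta_minus_pos_iff a False by blast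
    moreover have "w (\<theta> - \<eta>) \<in> R" using weyl_in_R[OF w_weyl] h pos_in_R by (auto simp: H_iff)
    ultimately have "- w (\<theta> - \<eta>) \<in> pos" using pos_or_neg by blast
    then have "w (\<theta> - \<eta>) \<in> uminus ` pos" by (metis add.inverse_inverse imageI)
    then have "\<theta> - \<eta> \<in> inv_set R P w" using h by (simp add: inv_set_def H_iff)
    then have "\<theta> - (\<theta> - \<eta>) \<in> Imin" unfolding I_min_def by blast
    then show ?thesis by simp
  qed (simp add: I_min_def)
qed

lemma I_min_complement:
  assumes "\<gamma> \<in> H" "\<gamma> \<noteq> \<theta>" shows "\<theta> - \<gamma> \<in> Imin \<longleftrightarrow> \<gamma> \<notin> Imin"
  using I_min_iff assms theta_minus_H w_theta_minus_pos_iff by blast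

lemma theta_in_I_min: "\<theta> \<in> Imin"
  by (simp add: I_min_def)

lemma I_min_pos: "\<eta> \<in> Imin \<Longrightarrow> \<eta> \<in> pos"
  by (simp add: I_min_iff H_iff)

lemma I_min_upper: "upper_ideal R P Imin"
  unfolding upper_ideal_def
proof (intro conjI ballI impI)
  show "Imin \<subseteq> pos" using I_min_pos by blast
  fix \<gamma> \<nu> assume g: "\<gamma> \<in> Imin" and n: "\<nu> \<in> pos" and s: "\<nu> + \<gamma> \<in> pos"
  have gH: "\<gamma> \<in> H" and wg: "w \<gamma> \<in> pos" using g by (auto simp: I_min_iff)
  have sH: "\<nu> + \<gamma> \<in> H" using H_upper gH n s by blast
  show "\<nu> + \<gamma> \<in> Imin"
  \<comment> \<open>If \<open>\<nu>\<close> is orthogonal to \<open>\<theta>\<close>, then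
    \<open>w\<close> keeps it positive; otherwise both summands lie in \<open>H\<close> and the sum
    is \<open>\<theta>\<close>.\<close>
  proof (cases "\<nu> \<bullet> \<theta> = 0")
    case True
    have "w (\<nu> + \<gamma>) = w \<nu> + w \<gamma>" using linear_add[OF weyl_linear[OF w_weyl]] by blast
    moreover have "w (\<nu> + \<gamma>) \<in> R" using weyl_in_R[OF w_weyl] s pos_in_R by blast
    ultimately have "w (\<nu> + \<gamma>) \<in> pos" using pos_add w_perp[OF n True] wg by metis
    then show ?thesis using sH by (simp add: I_min_iff)
  next
    case False
    then have "\<nu> \<in> H" using theta_dominant[OF n] n by (simp add: H_iff)
    then have "\<nu> + \<gamma> = \<theta>" using H_add_eq_theta gH s pos_in_R by blast
    then show ?thesis using theta_in_I_min by simp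
  qed
qed

lemma I_min_up: "\<gamma> \<in> Imin \<Longrightarrow> \<mu> \<in> pos \<Longrightarrow> \<gamma> \<preceq> \<mu> \<Longrightarrow> \<mu> \<in> Imin"
  by (rule upper_ideal_rprec[OF I_min_upper])

text \<open>An element of \<open>H\<close> outside \<open>Imin\<close> has its complement in
  \<open>Imin\<close>, and the two add up to the root \<open>\<theta>\<close>. Conversely, two
  elements of \<open>Imin\<close> whose sum is a root would be complementary.\<close>

lemma centralizer_Int_H: "centralizer \<alpha> \<inter> H = Imin"
proof (intro set_eqI iffI)
  fix \<gamma> assume g: "\<gamma> \<in> centralizer \<alpha> \<inter> H"
  show "\<gamma> \<in> Imin"
  proof (rule ccontr)
    assume n: "\<gamma> \<notin> Imin"
    then have "\<gamma> \<noteq> \<theta>" using theta_in_I_min by blast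
    then have "\<theta> - \<gamma> \<in> Imin" using I_min_complement g n by blast
    then have "\<gamma> + (\<theta> - \<gamma>) \<notin> R" using g by (auto simp only: centralizer_def)
    then show False using theta_in_R by simp
  qed
next
  fix \<gamma> assume g: "\<gamma> \<in> Imin"
  have gH: "\<gamma> \<in> H" using g I_min_iff by blast
  have "\<gamma> + \<eta> \<notin> R" if e: "\<eta> \<in> Imin" for \<eta>
  proof
    assume s: "\<gamma> + \<eta> \<in> R"
    have "\<gamma> + \<eta> = \<theta>" using H_add_eq_theta gH s e I_min_iff by blast
    then have e': "\<eta> = \<theta> - \<gamma>" by (simp add: algebra_simps)
    moreover have "\<gamma> \<noteq> \<theta>" using theta_plus_notin_R I_min_pos[OF e] s by blast
    ultimately show False using I_min_complement[OF gH] g e by blast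
  qed
  then show "\<gamma> \<in> centralizer \<alpha> \<inter> H" using gH by (auto simp: centralizer_def H_iff)
qed

lemma centralizer_upper: "upper_ideal R P (centralizer \<alpha>)"
  unfolding upper_ideal_def
proof (intro conjI ballI impI)
  show "centralizer \<alpha> \<subseteq> pos" by (auto simp: centralizer_def)
  fix \<gamma> \<nu> assume g: "\<gamma> \<in> centralizer \<alpha>" and n: "\<nu> \<in> pos" and s: "\<nu> + \<gamma> \<in> pos"
  have gp: "\<gamma> \<in> pos" and c: "\<And>\<eta>. \<eta> \<in> Imin \<Longrightarrow> \<gamma> + \<eta> \<notin> R"
    using g by (auto simp: centralizer_def)
  have "\<nu> + \<gamma> + \<eta> \<notin> R" if e: "\<eta> \<in> Imin" for \<eta>
  proof
    assume t: "\<nu> + \<gamma> + \<eta> \<in> R"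
    \<comment> \<open>\<open>\<gamma> + \<eta>\<close> is not a root, so \<open>\<nu>\<close> can be
      absorbed by \<open>\<eta>\<close>; this stays in \<open>Imin\<close>, and
      \<open>\<gamma>\<close> must not add to it.\<close>
    then have "\<nu> + \<eta> \<in> R"
      using sum_of_three[OF n gp I_min_pos[OF e] pos_in_R[OF s]] c[OF e] by blast
    then have "\<nu> + \<eta> \<in> Imin"
      using I_min_upper e n pos_add I_min_pos unfolding upper_ideal_def by blast
    from c[OF this] show False using t by (simp add: algebra_simps)
  qed
  then show "\<nu> + \<gamma> \<in> centralizer \<alpha>" using s by (simp add: centralizer_def)
qed

text \<open>Two offending elements can be raised inside the centralizer until they add up to
  \<open>\<theta>\<close>. One of them is then in \<open>H\<close>, hence both are, and
  \<open>Imin\<close> would contain a complementary pair.\<close>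

lemma centralizer_abelian: "abelian_ideal R P (centralizer \<alpha>)"
  unfolding abelian_ideal_def
proof (intro ballI notI)
  fix \<gamma> \<nu> assume g: "\<gamma> \<in> centralizer \<alpha>" "\<nu> \<in> centralizer \<alpha>" and s: "\<gamma> + \<nu> \<in> pos"
  have p: "\<gamma> \<in> pos" "\<nu> \<in> pos" using g by (auto simp: centralizer_def)
  obtain \<gamma>' \<nu>' where r: "\<gamma>' \<in> pos" "\<nu>' \<in> pos" "\<gamma> \<preceq> \<gamma>'" "\<nu> \<preceq> \<nu>'" "\<gamma>' + \<nu>' = \<theta>"
    using sum_raise_to_theta[OF p pos_in_R[OF s]] by blast
  then have c: "\<gamma>' \<in> centralizer \<alpha>" "\<nu>' \<in> centralizer \<alpha>"
    using upper_ideal_rprec[OF centralizer_upper] g by blast+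
  have notboth: False if "x \<in> centralizer \<alpha>" "y \<in> centralizer \<alpha>" "x + y = \<theta>" "x \<in> H" for x y
  proof -
    have "y \<noteq> 0" using that(2) pos_in_R zero_notin_R by (auto simp: centralizer_def)
    then have ne: "x \<noteq> \<theta>" using that(3) by auto
    have y: "y = \<theta> - x" using that(3) by (simp add: algebra_simps)
    have "y \<in> H" using theta_minus_H[OF that(4) ne] y by simp
    then have "x \<in> Imin" "y \<in> Imin" using that centralizer_Int_H by blast+
    then show False using I_min_complement[OF that(4) ne] y by simp
  qed
  have "\<gamma>' \<bullet> \<theta> + \<nu>' \<bullet> \<theta> > 0"
    using r(5) inner_pos[OF theta_in_R] by (metis inner_add_left)
  then have "\<gamma>' \<in> H \<or> \<nu>' \<in> H" using r by (auto simp: H_iff)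
  then show False
    using notboth[OF c r(5)] notboth[OF c(2,1)] r(5) by (auto simp: add.commute)
qed

text \<open>Any competing ideal contains \<open>Imin\<close> and is abelian, hence lies in the
  centralizer. As the centralizer competes too, it is the greatest, which determines the
  \<open>THE\<close>.\<close>

lemma I_max_eq_centralizer: "I_max R P \<theta> \<alpha> = centralizer \<alpha>"
proof -
  define F where "F = {J. J \<noteq> {} \<and> upper_ideal R P J \<and> abelian_ideal R P J \<and> J \<inter> H = Imin}"
  have c: "centralizer \<alpha> \<in> F"
    using centralizer_upper centralizer_abelian centralizer_Int_H theta_in_I_min
    unfolding F_def by blast
  have sub: "J \<subseteq> centralizer \<alpha>" if J: "J \<in> F" for J
  proof
    fix \<gamma> assume g: "\<gamma> \<in> J"
    have u: "J \<subseteq> pos" "Imin \<subseteq> J" using J by (auto simp: F_def upper_ideal_def)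
    have "\<gamma> + \<eta> \<notin> R" if e: "\<eta> \<in> Imin" for \<eta>
    proof
      assume "\<gamma> + \<eta> \<in> R"
      then have "\<gamma> + \<eta> \<in> pos" using pos_add u g e by blast
      then show False using J u g e unfolding F_def abelian_ideal_def by blast
    qed
    then show "\<gamma> \<in> centralizer \<alpha>" using g u by (auto simp: centralizer_def)
  qed
  have "(THE I. I \<in> F \<and> (\<forall>J\<in>F. I \<subseteq> J \<longrightarrow> J = I)) = centralizer \<alpha>"
  proof (rule the_equality)
    show "centralizer \<alpha> \<in> F \<and> (\<forall>J\<in>F. centralizer \<alpha> \<subseteq> J \<longrightarrow> J = centralizer \<alpha>)"
      using c sub by blast
  next
    fix I assume "I \<in> F \<and> (\<forall>J\<in>F. I \<subseteq> J \<longrightarrow> J = I)"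
    then show "I = centralizer \<alpha>" using c sub by blast
  qed
  then show ?thesis unfolding I_max_def Let_def F_def .
qed

end

text \<open>The order-reversing map sends \<open>X\<close> without \<open>\<theta>\<close> into
  \<open>Y\<close>, and every element of \<open>Y\<close> lies below some image
  (\<open>X_to_Y\<close>, \<open>Y_to_X\<close>). Minimal and maximal elements then correspond once
  \<open>\<theta>\<close> is known not to be minimal in \<open>X\<close>.\<close>

lemma bij_minimal_maximal:
  assumes a0: "\<alpha>\<^sub>0 \<in> P" "\<alpha>\<^sub>0 \<bullet> \<theta> > 0" "\<alpha>\<^sub>0 \<noteq> \<theta>"
    and unique: "\<And>\<beta>. \<beta> \<in> P \<Longrightarrow> \<beta> \<bullet> \<theta> > 0 \<Longrightarrow> \<beta> = \<alpha>\<^sub>0"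
    and S: "S \<subseteq> simple_long_roots R P" "S \<noteq> {}"
  shows "bij_betw (\<lambda>\<eta>. \<theta> - \<eta>)
           (minimal_elems P (\<Inter>\<alpha>\<in>S. I_min R P \<theta> \<alpha>))
           (maximal_elems P (pos - (\<Union>\<alpha>\<in>S. I_max R P \<theta> \<alpha>)))"
proof -
  define X where "X = (\<Inter>\<alpha>\<in>S. I_min R P \<theta> \<alpha>)"
  define Y where "Y = pos - (\<Union>\<alpha>\<in>S. I_max R P \<theta> \<alpha>)"
  have Y_iff: "\<gamma> \<in> Y \<longleftrightarrow> \<gamma> \<in> pos \<and> (\<forall>\<alpha>\<in>S. \<exists>\<eta>\<in>I_min R P \<theta> \<alpha>. \<gamma> + \<eta> \<in> R)" for \<gamma>
  proof -
    have "I_max R P \<theta> \<alpha> = centralizer \<alpha>" if "\<alpha> \<in> S" for \<alpha>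
      using I_max_eq_centralizer S(1) that by blast
    then show ?thesis by (auto simp: Y_def centralizer_def)
  qed
  \<comment> \<open>Among simple roots only \<open>\<alpha>\<^sub>0\<close> contributes to the
    pairing with \<open>\<theta>\<close>, so its coefficient in \<open>\<gamma>\<close> cannot
    vanish.\<close>
  have above_a0: "\<alpha>\<^sub>0 \<preceq> \<gamma>" if g: "\<gamma> \<in> H" for \<gamma>
  proof -
    have "cf \<gamma> \<alpha>\<^sub>0 \<noteq> 0"
    proof
      assume z: "cf \<gamma> \<alpha>\<^sub>0 = 0"
      have t: "cf \<gamma> \<beta> * (\<beta> \<bullet> \<theta>) = 0" if "\<beta> \<in> P" for \<beta>
        using unique[OF that] z theta_dominant[OF P_pos[OF that]] by (cases "\<beta> \<bullet> \<theta> = 0") auto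
      then have "\<gamma> \<bullet> \<theta> = 0" by (subst inner_expand) (rule sum.neutral, use t in blast)
      then show False using g by (simp add: H_iff)
    qed
    moreover have p: "\<gamma> \<in> pos" using g by (simp add: H_iff)
    ultimately have "cf \<gamma> \<alpha>\<^sub>0 > 0" using pos_cf_nonneg[OF p a0(1)] by linarith
    then have "cf \<gamma> \<alpha>\<^sub>0 - 1 \<in> \<nat>"
      using cf_root_Ints[OF pos_in_R[OF p] a0(1)] by (auto simp: Nats_altdef2 elim!: Ints_cases)
    then show ?thesis
      using p by (auto simp: rprec_iff cf_basis[OF a0(1)] pos_roots_def nonneg_comb_iff)
  qed
  have X_in_H: "\<eta> \<in> H" if "\<eta> \<in> X" for \<eta>
    using that S I_min_iff by (fastforce simp: X_def)
  have X_to_Y: "\<theta> - \<eta> \<in> Y" if e: "\<eta> \<in> X" "\<eta> \<noteq> \<theta>" for \<eta>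
  proof -
    have "\<theta> - \<eta> \<in> pos" using theta_minus_H[OF X_in_H] e by (simp add: H_iff)
    moreover have "\<theta> - \<eta> + \<eta> \<in> R" using theta_in_R by simp
    ultimately show ?thesis using e(1) unfolding Y_iff X_def by blast
  qed
  have Y_to_X: "\<exists>\<eta>\<in>X. \<eta> \<noteq> \<theta> \<and> \<gamma> \<preceq> \<theta> - \<eta>" if g: "\<gamma> \<in> Y" for \<gamma>
  proof -
    have gp: "\<gamma> \<in> pos" using g by (simp add: Y_iff)
    have "\<exists>\<eta>. \<eta> \<in> I_min R P \<theta> \<alpha> \<and> \<eta> \<preceq> \<theta> - \<gamma>" if al: "\<alpha> \<in> S" for \<alpha>
    proof -
      have al': "\<alpha> \<in> simple_long_roots R P" using al S by blast
      obtain \<eta> where e: "\<eta> \<in> I_min R P \<theta> \<alpha>" "\<gamma> + \<eta> \<in> R" using g al by (auto simp: Y_iff)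
      obtain \<gamma>' \<eta>' where r: "\<gamma>' \<in> pos" "\<eta>' \<in> pos" "\<gamma> \<preceq> \<gamma>'" "\<eta> \<preceq> \<eta>'" "\<gamma>' + \<eta>' = \<theta>"
        using sum_raise_to_theta[OF gp I_min_pos[OF al' e(1)] e(2)] by blast
      have "\<gamma>' = \<theta> - \<eta>'" using r(5) by (simp add: algebra_simps)
      then have "\<eta>' \<preceq> \<theta> - \<gamma>" using r(3) rprec_diff_swap by simp
      then show ?thesis using I_min_up[OF al' e(1) r(2,4)] by blast
    qed
    then obtain h where h: "\<And>\<alpha>. \<alpha> \<in> S \<Longrightarrow> h \<alpha> \<in> I_min R P \<theta> \<alpha> \<and> h \<alpha> \<preceq> \<theta> - \<gamma>" by metis
    have hH: "h \<alpha> \<in> H" if "\<alpha> \<in> S" for \<alpha> using h[OF that] S that I_min_iff by blast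
    \<comment> \<open>The separate witnesses \<open>h \<alpha>\<close> all lie above
      \<open>\<alpha>\<^sub>0\<close> and below \<open>\<theta> - \<gamma>\<close>, so a single root
      bounds them; it belongs to every upper ideal
      \<open>I_min R P \<theta> \<alpha>\<close>.\<close>
    have "\<exists>m\<in>pos. m \<preceq> \<theta> - \<gamma> \<and> (\<forall>\<eta>\<in>h ` S. \<eta> \<preceq> m)"
      using S(2) h hH above_a0 by (intro ex_upper_bound_below[OF a0(1)]) (auto simp: H_iff)
    then obtain m where m: "m \<in> pos" "m \<preceq> \<theta> - \<gamma>" "\<And>\<alpha>. \<alpha> \<in> S \<Longrightarrow> h \<alpha> \<preceq> m" by blast
    have "m \<in> X" unfolding X_def using I_min_up[of _ "h _" m] h m S by blast
    moreover have le: "\<gamma> \<preceq> \<theta> - m" using m(2) rprec_diff_swap by blast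
    moreover have "m \<noteq> \<theta>"
    proof
      assume "m = \<theta>"
      then have "\<gamma> \<preceq> 0" using le by simp
      then have "\<forall>\<beta>\<in>P. cf \<gamma> \<beta> \<le> 0" using rprec_cf_le[of \<gamma> 0] by (simp add: cf_zero)
      then show False using ex_cf_pos[OF gp] by fastforce
    qed
    ultimately show ?thesis by blast
  qed
  have a0H: "\<alpha>\<^sub>0 \<in> H" using a0 P_pos by (simp add: H_iff)
  \<comment> \<open>Together with \<open>Y_to_X\<close> this provides an element of \<open>X\<close>
    other than \<open>\<theta>\<close>.\<close>
  have "\<alpha>\<^sub>0 \<in> Y"
  proof -
    have "\<exists>\<eta>\<in>I_min R P \<theta> \<alpha>. \<alpha>\<^sub>0 + \<eta> \<in> R" if al: "\<alpha> \<in> S" for \<alpha>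
    proof -
      have al': "\<alpha> \<in> simple_long_roots R P" using al S by blast
      have comp: "\<theta> - \<alpha>\<^sub>0 \<in> I_min R P \<theta> \<alpha> \<longleftrightarrow> \<alpha>\<^sub>0 \<notin> I_min R P \<theta> \<alpha>"
        using I_min_complement[OF al' a0H a0(3)] .
      have "\<theta> - \<alpha>\<^sub>0 \<in> H" using theta_minus_H[OF a0H a0(3)] .
      \<comment> \<open>As \<open>\<alpha>\<^sub>0 \<preceq> \<theta> - \<alpha>\<^sub>0\<close>, an
        ideal containing \<open>\<alpha>\<^sub>0\<close> would contain both members of a
        complementary pair; so \<open>\<theta> - \<alpha>\<^sub>0\<close> is always the member
        chosen.\<close>
      then have "\<theta> - \<alpha>\<^sub>0 \<in> I_min R P \<theta> \<alpha>"
        using I_min_up[OF al', of \<alpha>\<^sub>0 "\<theta> - \<alpha>\<^sub>0"] above_a0 comp by (auto simp: H_iff)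
      then show ?thesis using theta_in_R by (intro bexI[of _ "\<theta> - \<alpha>\<^sub>0"]) auto
    qed
    then show ?thesis using P_pos a0 by (auto simp: Y_iff)
  qed
  then obtain \<eta>0 where e0: "\<eta>0 \<in> X" "\<eta>0 \<noteq> \<theta>" using Y_to_X by blast
  have min_ne: "\<eta> \<noteq> \<theta>" if "\<eta> \<in> minimal_elems P X" for \<eta>
  proof
    assume "\<eta> = \<theta>"
    moreover have "\<eta>0 \<preceq> \<theta>" using rprec_theta X_in_H[OF e0(1)] by (simp add: H_iff)
    ultimately show False using that e0 by (auto simp: minimal_elems_def)
  qed
  have "bij_betw (\<lambda>\<eta>. \<theta> - \<eta>) (minimal_elems P X) (maximal_elems P Y)"
  proof (rule bij_betw_imageI)
    show "inj_on (\<lambda>\<eta>. \<theta> - \<eta>) (minimal_elems P X)" by (auto simp: inj_on_def)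
    show "(\<lambda>\<eta>. \<theta> - \<eta>) ` minimal_elems P X = maximal_elems P Y"
    proof (intro set_eqI iffI)
      fix x assume "x \<in> (\<lambda>\<eta>. \<theta> - \<eta>) ` minimal_elems P X"
      then obtain \<eta> where e: "\<eta> \<in> minimal_elems P X" "x = \<theta> - \<eta>" by blast
      have eX: "\<eta> \<in> X" and emin: "\<And>y. y \<in> X \<Longrightarrow> y \<preceq> \<eta> \<Longrightarrow> y = \<eta>"
        using e(1) by (auto simp: minimal_elems_def)
      have "\<gamma> = x" if g: "\<gamma> \<in> Y" "x \<preceq> \<gamma>" for \<gamma>
      proof -
        obtain \<eta>' where e': "\<eta>' \<in> X" "\<gamma> \<preceq> \<theta> - \<eta>'" using Y_to_X[OF g(1)] by blast
        then have "\<theta> - \<eta> \<preceq> \<theta> - \<eta>'" using g(2) e(2) rprec_trans by blast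
        then have "\<eta>' = \<eta>" using emin e'(1) rprec_diff_iff by blast
        then show ?thesis using e' e(2) g(2) rprec_antisym by blast
      qed
      moreover have "x \<in> Y" using X_to_Y[OF eX min_ne[OF e(1)]] e(2) by simp
      ultimately show "x \<in> maximal_elems P Y" by (auto simp: maximal_elems_def)
    next
      fix x assume "x \<in> maximal_elems P Y"
      then have xY: "x \<in> Y" and xmax: "\<And>y. y \<in> Y \<Longrightarrow> x \<preceq> y \<Longrightarrow> y = x"
        by (auto simp: maximal_elems_def)
      obtain \<eta> where e: "\<eta> \<in> X" "\<eta> \<noteq> \<theta>" "x \<preceq> \<theta> - \<eta>" using Y_to_X[OF xY] by blast
      have x: "\<theta> - \<eta> = x" using xmax[OF X_to_Y[OF e(1,2)] e(3)] .
      have "y = \<eta>" if y: "y \<in> X" "y \<preceq> \<eta>" for y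
      proof -
        have "y \<noteq> \<theta>"
          using y e(2) rprec_antisym rprec_theta X_in_H[OF e(1)] by (auto simp: H_iff)
        then have "\<theta> - y = x" using xmax[OF X_to_Y[OF y(1)]] x y(2) rprec_diff_iff by metis
        then show ?thesis using x by (metis diff_diff_eq2 add_diff_cancel_left' diff_add_cancel)
      qed
      then have "\<eta> \<in> minimal_elems P X" using e(1) by (auto simp: minimal_elems_def)
      then show "x \<in> (\<lambda>\<eta>. \<theta> - \<eta>) ` minimal_elems P X" using x by blast
    qed
  qed
  then show ?thesis by (simp only: X_def Y_def)
qed

section \<open>Simple roots not orthogonal to the highest root\<close>

text \<open>If the support of \<open>\<theta>\<close> were proper, connectedness would give a simple
  root outside it adjacent to one inside, and that root would pair negatively with the dominant
  \<open>\<theta>\<close>.\<close>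

lemma cf_theta_ge_1:
  assumes irr: "irreducible_rs R" and b: "\<beta> \<in> P"
  shows "cf \<theta> \<beta> \<ge> 1"
proof -
  let ?Z = "{\<beta>\<in>P. cf \<theta> \<beta> = 0}"
  have "?Z = {}"
  proof (rule ccontr)
    assume "?Z \<noteq> {}"
    moreover have "?Z \<noteq> P" using ex_cf_nonzero[OF theta_in_R] by blast
    ultimately obtain \<alpha> \<delta> where ad: "\<alpha> \<in> ?Z" "\<delta> \<in> P - ?Z" "\<alpha> \<bullet> \<delta> \<noteq> 0"
      using simple_roots_connected[OF irr, of ?Z] by blast
    have term_le: "cf \<theta> \<gamma> * (\<gamma> \<bullet> \<alpha>) \<le> 0" if "\<gamma> \<in> P" for \<gamma>
      using ad(1) simple_inner_le_0[OF that, of \<alpha>] pos_cf_nonneg[OF theta_pos that]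
      by (cases "\<gamma> = \<alpha>") (auto simp: mult_nonneg_nonpos)
    have "cf \<theta> \<delta> > 0" using ad pos_cf_nonneg[OF theta_pos, of \<delta>] by auto
    moreover have "\<delta> \<bullet> \<alpha> < 0"
      using simple_inner_le_0[of \<delta> \<alpha>] ad by (auto simp: inner_commute order_le_less)
    ultimately have "cf \<theta> \<delta> * (\<delta> \<bullet> \<alpha>) < 0" by (rule mult_pos_neg)
    then have "(\<Sum>\<gamma>\<in>P. cf \<theta> \<gamma> * (\<gamma> \<bullet> \<alpha>)) < (\<Sum>\<gamma>\<in>P. 0)"
      using ad term_le by (intro sum_strict_mono_ex1[OF finite_P]) auto
    then have "\<theta> \<bullet> \<alpha> < 0" by (simp only: inner_expand[of \<theta>, symmetric] sum.neutral_const)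
    moreover have "\<theta> \<bullet> \<alpha> \<ge> 0" using ad(1) by (intro theta_dominant_simple) blast
    ultimately show False by linarith
  qed
  then have "cf \<theta> \<beta> > 0" using b pos_cf_nonneg[OF theta_pos b] by force
  then show ?thesis using cf_root_Ints[OF theta_in_R b] by (auto elim!: Ints_cases)
qed

lemma cartan_expand: "cartan x \<gamma> = (\<Sum>\<beta>\<in>P. cf x \<beta> * cartan \<beta> \<gamma>)"
proof -
  have "cartan x \<gamma> = 2 * (\<Sum>\<beta>\<in>P. cf x \<beta> * (\<beta> \<bullet> \<gamma>)) / (\<gamma> \<bullet> \<gamma>)"
    unfolding cartan_def inner_expand[of x \<gamma>, symmetric] by (rule HOL.refl)
  also have "\<dots> = (\<Sum>\<beta>\<in>P. cf x \<beta> * cartan \<beta> \<gamma>)"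
    unfolding sum_distrib_left sum_divide_distrib by (intro sum.cong) (simp_all add: cartan_def)
  finally show ?thesis .
qed

text \<open>Every simple root is below \<open>\<theta>\<close>, so a simple \<open>\<theta>\<close>
  is the only one: rank 1, where the conditions on pairs are vacuous.\<close>

lemma theta_eq_simple_type_A:
  assumes "\<theta> \<in> P" shows "type_A P"
proof -
  have "P = {\<theta>}" using assms rprec_simple rprec_theta P_pos by blast
  then show ?thesis unfolding type_A_def
    by (intro exI[of _ 1] exI[of _ "\<lambda>_. \<theta>"]) (auto simp: bij_betw_def)
qed

text \<open>Two simple roots not orthogonal to \<open>\<theta>\<close> use up \<open>\<Sum>\<^sub>\<beta> n\<^sub>\<beta> (\<beta>, \<theta>\<^sup>\<or>) = 2\<close>. Then
  \<open>(\<theta>, \<beta>\<^sup>\<or>) \<ge> 0\<close> leaves each node of the Dynkin diagram reached from \<open>a\<close> room for a single further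
  neighbour, with \<open>n\<^sub>\<beta> = 1\<close>, so the diagram is a chain; it can only stop at \<open>b\<close>.\<close>

context
  fixes a b :: 'a
  assumes irr: "irreducible_rs R"
    and ab: "a \<in> P" "b \<in> P" "a \<noteq> b" "\<theta> \<bullet> a > 0" "\<theta> \<bullet> b > 0"
begin

lemma ends:
  assumes "x \<in> {a, b}" shows "cf \<theta> x = 1" "cartan x \<theta> = 1"
proof -
  have c: "cartan y \<theta> \<ge> 1" if "y \<in> {a, b}" for y
    using that ab P_pos by (intro cartan_theta_H) (auto simp: H_iff inner_commute)
  have t: "cf \<theta> y * cartan y \<theta> \<ge> cartan y \<theta>" "cf \<theta> y * cartan y \<theta> \<ge> cf \<theta> y"
    if "y \<in> {a, b}" for y
    using c[OF that] cf_theta_ge_1[OF irr, of y] that ab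
      mult_right_mono[of 1 "cf \<theta> y" "cartan y \<theta>"] mult_left_mono[of 1 "cartan y \<theta>" "cf \<theta> y"] by auto
  have "(\<Sum>\<beta>\<in>{a, b}. cf \<theta> \<beta> * cartan \<beta> \<theta>) \<le> (\<Sum>\<beta>\<in>P. cf \<theta> \<beta> * cartan \<beta> \<theta>)"
  proof (rule sum_mono2[OF finite_P])
    fix \<beta> assume "\<beta> \<in> P - {a, b}"
    then show "0 \<le> cf \<theta> \<beta> * cartan \<beta> \<theta>"
      using theta_dominant[OF P_pos] pos_cf_nonneg[OF theta_pos]
      by (simp add: cartan_def)
  qed (use ab in auto)
  then have "cf \<theta> a * cartan a \<theta> + cf \<theta> b * cartan b \<theta> \<le> 2"
    using cartan_expand[of \<theta> \<theta>] cartan_self[OF theta_in_R] ab by simp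
  moreover have "cf \<theta> a \<ge> 1" "cf \<theta> b \<ge> 1" using ab cf_theta_ge_1[OF irr] by blast+
  ultimately have "cf \<theta> a = 1 \<and> cartan a \<theta> = 1 \<and> cf \<theta> b = 1 \<and> cartan b \<theta> = 1"
    using t(1)[of a, OF insertI1] t(2)[of a, OF insertI1] t(1)[of b, OF insertI2[OF insertI1]]
      t(2)[of b, OF insertI2[OF insertI1]] c[of a, OF insertI1] c[of b, OF insertI2[OF insertI1]]
    by linarith
  then show "cf \<theta> x = 1" "cartan x \<theta> = 1" using assms by blast+
qed

text \<open>In the expansion of the pairing, \<open>\<gamma>\<close> itself contributes 2 and all
  other simple roots contribute nonpositively, so those outside \<open>B\<close> may be
  dropped.\<close>

lemma cartan_theta_bound:
  assumes g: "\<gamma> \<in> P" "cf \<theta> \<gamma> = 1" and B: "B \<subseteq> P - {\<gamma>}"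
  shows "cartan \<theta> \<gamma> \<le> 2 + (\<Sum>\<beta>\<in>B. cf \<theta> \<beta> * cartan \<beta> \<gamma>)"
proof -
  have "(\<Sum>\<beta>\<in>P - {\<gamma>}. cf \<theta> \<beta> * cartan \<beta> \<gamma>) \<le> (\<Sum>\<beta>\<in>B. cf \<theta> \<beta> * cartan \<beta> \<gamma>)"
  proof -
    have "(\<Sum>\<beta>\<in>P - {\<gamma>} - B. cf \<theta> \<beta> * cartan \<beta> \<gamma>) \<le> 0"
    proof (rule sum_nonpos)
      fix \<beta> assume "\<beta> \<in> P - {\<gamma>} - B"
      then have "\<beta> \<bullet> \<gamma> \<le> 0" "cf \<theta> \<beta> \<ge> 0"
        using simple_inner_le_0 g pos_cf_nonneg[OF theta_pos] by auto
      then show "cf \<theta> \<beta> * cartan \<beta> \<gamma> \<le> 0"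
        by (simp add: cartan_def mult_nonneg_nonpos divide_nonpos_nonneg)
    qed
    moreover have "(\<Sum>\<beta>\<in>P - {\<gamma>}. cf \<theta> \<beta> * cartan \<beta> \<gamma>) =
      (\<Sum>\<beta>\<in>P - {\<gamma>} - B. cf \<theta> \<beta> * cartan \<beta> \<gamma>) + (\<Sum>\<beta>\<in>B. cf \<theta> \<beta> * cartan \<beta> \<gamma>)"
      by (rule sum.subset_diff[OF B finite_Diff[OF finite_P]])
    ultimately show ?thesis by linarith
  qed
  moreover have "cartan \<theta> \<gamma> = cf \<theta> \<gamma> * cartan \<gamma> \<gamma> + (\<Sum>\<beta>\<in>P - {\<gamma>}. cf \<theta> \<beta> * cartan \<beta> \<gamma>)"
    by (subst cartan_expand) (rule sum.remove[OF finite_P g(1)])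
  ultimately show ?thesis using g cartan_self[OF P_in_R[OF g(1)]] by simp
qed

lemma neighbour_term:
  assumes "\<beta> \<in> P" "\<gamma> \<in> P" "\<beta> \<noteq> \<gamma>" "\<beta> \<bullet> \<gamma> \<noteq> 0"
  shows "cf \<theta> \<beta> * cartan \<beta> \<gamma> \<le> - cf \<theta> \<beta>" "cf \<theta> \<beta> * cartan \<beta> \<gamma> \<le> cartan \<beta> \<gamma>"
    "cf \<theta> \<beta> * cartan \<beta> \<gamma> \<le> -1"
proof -
  have c: "cartan \<beta> \<gamma> \<le> -1" and n: "cf \<theta> \<beta> \<ge> 1"
    using cartan_simple_le_minus_1 cf_theta_ge_1[OF irr] assms by auto
  show 1: "cf \<theta> \<beta> * cartan \<beta> \<gamma> \<le> - cf \<theta> \<beta>" using mult_left_mono[OF c, of "cf \<theta> \<beta>"] n by simp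
  show "cf \<theta> \<beta> * cartan \<beta> \<gamma> \<le> cartan \<beta> \<gamma>"
    using mult_right_mono_neg[OF n, of "cartan \<beta> \<gamma>"] c by simp
  show "cf \<theta> \<beta> * cartan \<beta> \<gamma> \<le> -1" using 1 n by linarith
qed

lemma cartan_theta_nonneg: "\<gamma> \<in> P \<Longrightarrow> cartan \<theta> \<gamma> \<ge> 0"
  using theta_dominant_simple by (simp add: cartan_def)

lemma cartan_theta_ends: "x \<in> {a, b} \<Longrightarrow> cartan \<theta> x \<ge> 1"
proof -
  assume "x \<in> {a, b}"
  then have "cartan \<theta> x > 0" "cartan \<theta> x \<in> \<int>"
    using ab cartan_pos_iff cartan_Ints theta_in_R P_in_R by auto
  then show ?thesis by (auto elim!: Ints_cases)
qed

text \<open>Both Cartan integers between \<open>x\<close> and \<open>\<theta>\<close> are then 1,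
  which forces equal lengths.\<close>

lemma end_long: "x \<in> {a, b} \<Longrightarrow> cartan \<theta> x \<le> 1 \<Longrightarrow> x \<bullet> x = \<theta> \<bullet> \<theta>"
proof -
  assume x: "x \<in> {a, b}" and "cartan \<theta> x \<le> 1"
  then have "cartan \<theta> x = 1" using cartan_theta_ends by (simp add: order_antisym)
  moreover have "x \<bullet> x > 0" using x ab P_in_R inner_pos by blast
  ultimately show ?thesis
    using ends(2)[OF x] inner_pos[OF theta_in_R] by (simp add: cartan_def inner_commute field_simps)
qed

text \<open>Only one of the two Cartan integers of each link is fixed; the other follows later from
  equality of lengths. The last clause says that only the final node may have neighbours outside the
  chain.\<close>

definition chain :: "nat \<Rightarrow> (nat \<Rightarrow> 'a) \<Rightarrow> bool" where
  "chain k f \<longleftrightarrow> inj_on f {1..k} \<and> f ` {1..k} \<subseteq> P \<and> f 1 = a \<and>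
    (\<forall>i\<in>{1..<k}. cartan (f (i + 1)) (f i) = -1) \<and>
    (\<forall>i\<in>{1..k}. cf \<theta> (f i) = 1) \<and>
    (\<forall>i\<in>{1..k}. \<forall>j\<in>{1..k}. i + 1 < j \<longrightarrow> f i \<bullet> f j = 0) \<and>
    (\<forall>i\<in>{1..<k}. \<forall>\<beta>\<in>P - f ` {1..k}. f i \<bullet> \<beta> = 0)"

lemma chain_extend:
  assumes ch: "chain k f" and k: "1 \<le> k" "f ` {1..k} \<noteq> P"
  shows "\<exists>f. chain (Suc k) f"
proof -
  have inj: "inj_on f {1..k}" and sub: "f ` {1..k} \<subseteq> P" and f1: "f 1 = a"
    and c1: "\<And>i. i \<in> {1..<k} \<Longrightarrow> cartan (f (i + 1)) (f i) = -1"
    and n1: "\<And>i. i \<in> {1..k} \<Longrightarrow> cf \<theta> (f i) = 1"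
    and far: "\<And>i j. i \<in> {1..k} \<Longrightarrow> j \<in> {1..k} \<Longrightarrow> i + 1 < j \<Longrightarrow> f i \<bullet> f j = 0"
    and out: "\<And>i \<beta>. i \<in> {1..<k} \<Longrightarrow> \<beta> \<in> P - f ` {1..k} \<Longrightarrow> f i \<bullet> \<beta> = 0"
    using ch by (auto simp: chain_def)
  have kk: "k \<in> {1..k}" using k by simp
  then have fk: "f k \<in> P" "cf \<theta> (f k) = 1" using sub n1 by blast+
  have "f ` {1..k} \<noteq> {}" using k by simp
  then obtain i \<beta> where i: "i \<in> {1..k}" "\<beta> \<in> P - f ` {1..k}" "f i \<bullet> \<beta> \<noteq> 0"
    using simple_roots_connected[OF irr sub _ k(2)] by blast
  then have "\<not> i < k" using out[of i \<beta>] by auto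
  then have "i = k" using i(1) by simp
  then have b: "\<beta> \<in> P" "\<beta> \<notin> f ` {1..k}" "\<beta> \<bullet> f k \<noteq> 0" using i by (auto simp: inner_commute)
  have bk: "\<beta> \<noteq> f k" using b(2) kk by blast
  \<comment> \<open>Of the 2 in \<open>cartan_theta_bound\<close>, one unit is already spent: on
    \<open>cartan \<theta> a \<ge> 1\<close> at the first node, on the predecessor at any later
    one.\<close>
  have bound: "(\<Sum>\<delta>\<in>B. cf \<theta> \<delta> * cartan \<delta> (f k)) \<ge> -1" if B: "B \<subseteq> P - f ` {1..k}" for B
  proof (cases "k = 1")
    case True
    have "cartan \<theta> (f k) \<ge> 1" unfolding True f1 by (rule cartan_theta_ends) simp
    moreover have "B \<subseteq> P - {f k}" using B kk by blast
    ultimately show ?thesis using cartan_theta_bound[OF fk, of B] by linarith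
  next
    case False
    define p where "p = f (k - 1)"
    have k1: "k - 1 \<in> {1..k}" "k - 1 \<in> {1..<k}" "k - 1 \<noteq> k" using False k(1) by auto
    have pk: "p \<in> P" "p \<in> f ` {1..k}" "p \<noteq> f k"
      unfolding p_def using k1 kk sub inj_on_eq_iff[OF inj] by blast+
    have "cartan (f k) p = -1" using c1[OF k1(2)] k(1) by (simp add: p_def)
    then have "p \<bullet> f k \<noteq> 0"
      unfolding cartan_def by (metis divide_eq_0_iff inner_commute mult_zero_right neg_equal_0_iff_equal zero_neq_one)
    then have t: "cf \<theta> p * cartan p (f k) \<le> -1"
      by (rule neighbour_term(3)[OF pk(1) fk(1) pk(3)])
    have "insert p B \<subseteq> P - {f k}" using B kk pk by blast
    from cartan_theta_bound[OF fk this]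
    have "0 \<le> 2 + (\<Sum>\<delta>\<in>insert p B. cf \<theta> \<delta> * cartan \<delta> (f k))"
      using cartan_theta_nonneg[OF fk(1)] by linarith
    moreover have "p \<notin> B" "finite B" using B pk finite_P finite_subset by blast+
    ultimately show ?thesis using t by simp
  qed
  have "cf \<theta> \<beta> * cartan \<beta> (f k) \<ge> -1" using bound[of "{\<beta>}"] b by simp
  \<comment> \<open>A product of a coefficient at least 1 and a Cartan integer at most -1 can be at
    least -1 only if both are extreme.\<close>
  then have nb: "cf \<theta> \<beta> = 1" "cartan \<beta> (f k) = -1"
    using neighbour_term[OF b(1) fk(1) bk b(3)] cf_theta_ge_1[OF irr b(1)]
      cartan_simple_le_minus_1[OF b(1) fk(1) bk b(3)] by linarith+
  \<comment> \<open>A second outside neighbour would bring the sum down to -2.\<close>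
  have others: "f k \<bullet> \<delta> = 0" if d: "\<delta> \<in> P - f ` {1..k}" "\<delta> \<noteq> \<beta>" for \<delta>
  proof (rule ccontr)
    assume "f k \<bullet> \<delta> \<noteq> 0"
    moreover have "\<delta> \<noteq> f k" using d kk by blast
    ultimately have "cf \<theta> \<delta> * cartan \<delta> (f k) \<le> -1"
      using neighbour_term(3)[of \<delta> "f k"] d(1) fk(1) inner_commute[of \<delta>] by simp
    moreover have "(\<Sum>\<delta>\<in>{\<beta>, \<delta>}. cf \<theta> \<delta> * cartan \<delta> (f k)) \<ge> -1"
      using b d by (intro bound) blast
    then have "cf \<theta> \<beta> * cartan \<beta> (f k) + cf \<theta> \<delta> * cartan \<delta> (f k) \<ge> -1"
      using d(2) by (simp add: eq_commute[of \<beta>])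
    ultimately show False unfolding nb by linarith
  qed
  define g where "g = f(Suc k := \<beta>)"
  have gf: "\<And>i. i \<le> k \<Longrightarrow> g i = f i" and gk: "g (Suc k) = \<beta>" by (auto simp: g_def)
  have img: "g ` {1..k} = f ` {1..k}" using gf by (intro image_cong) auto
  have ins: "{1..Suc k} = insert (Suc k) {1..k}" by auto
  have img': "g ` {1..Suc k} = insert \<beta> (f ` {1..k})" unfolding ins image_insert img gk by (rule HOL.refl)
  have "inj_on g {1..k}" using inj by (subst inj_on_cong[of "{1..k}" g f]) (use gf in auto)
  moreover have "g (Suc k) \<notin> g ` ({1..k} - {Suc k})" using b(2) img gk by auto
  ultimately have "inj_on g {1..Suc k}" unfolding ins inj_on_insert by blast
  moreover have "g 1 = a" using f1 gf k by simp
  moreover have "cartan (g (i + 1)) (g i) = -1" if i: "i \<in> {1..<Suc k}" for i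
  proof (cases "i = k")
    case True
    then show ?thesis using nb(2) gf[of k] gk by simp
  next
    case False
    then have "i \<in> {1..<k}" using i by auto
    then show ?thesis using c1[of i] gf[of i] gf[of "i + 1"] by simp
  qed
  moreover have "cf \<theta> (g i) = 1" if i: "i \<in> {1..Suc k}" for i
  proof (cases "i = Suc k")
    case True
    then show ?thesis using nb(1) gk by simp
  next
    case False
    then have "i \<in> {1..k}" using i by auto
    then show ?thesis using n1[of i] gf[of i] by simp
  qed
  moreover have "g i \<bullet> g j = 0" if ij: "i \<in> {1..Suc k}" "j \<in> {1..Suc k}" "i + 1 < j" for i j
  proof (cases "j = Suc k")
    case True
    then have "i \<in> {1..<k}" using ij by auto
    then show ?thesis using out[of i \<beta>] b(1,2) True gf[of i] gk by simp
  next
    case False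
    then have "i \<in> {1..k}" "j \<in> {1..k}" using ij by auto
    then show ?thesis using far[of i j] ij(3) gf[of i] gf[of j] by simp
  qed
  moreover have "g i \<bullet> \<delta> = 0" if i: "i \<in> {1..<Suc k}" "\<delta> \<in> P - insert \<beta> (f ` {1..k})" for i \<delta>
  proof (cases "i = k")
    case True
    then show ?thesis using others[of \<delta>] i(2) gf[of k] by simp
  next
    case False
    then have "i \<in> {1..<k}" using i by auto
    then show ?thesis using out[of i \<delta>] i(2) gf[of i] by simp
  qed
  moreover have "insert \<beta> (f ` {1..k}) \<subseteq> P" using sub b(1) by blast
  ultimately have "chain (Suc k) g"
    unfolding chain_def img' by (intro conjI ballI impI)
  then show ?thesis by blast
qed

lemma ex_chain: "1 \<le> k \<Longrightarrow> k \<le> card P \<Longrightarrow> \<exists>f. chain k f"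
proof (induction k rule: dec_induct)
  case base
  have "chain 1 (\<lambda>_. a)" using ab ends(1)[of a] by (simp add: chain_def)
  then show ?case by blast
next
  case (step k)
  then obtain f where f: "chain k f" by auto
  then have "card (f ` {1..k}) = k" by (simp add: chain_def card_image)
  then have "f ` {1..k} \<noteq> P" using step by auto
  then show ?case using chain_extend[OF f] step by blast
qed

text \<open>A chain with \<open>card P\<close> nodes exhausts \<open>P\<close>. Its ends turn out to
  be \<open>a\<close> and \<open>b\<close>, both as long as \<open>\<theta>\<close>; lengths cannot
  increase along the chain, so all are equal and every link is simple.\<close>

lemma two_ends_type_A: "type_A P"
proof -
  define n where "n = card P"
  have n1: "1 \<le> n" using ab finite_P by (auto simp: n_def card_gt_0_iff Suc_le_eq)
  then obtain f where ch: "chain n f" using ex_chain n_def by blast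
  have inj: "inj_on f {1..n}" and sub: "f ` {1..n} \<subseteq> P" and f1: "f 1 = a"
    and c1: "\<And>i. i \<in> {1..<n} \<Longrightarrow> cartan (f (i + 1)) (f i) = -1"
    and cf1: "\<And>i. i \<in> {1..n} \<Longrightarrow> cf \<theta> (f i) = 1"
    and far: "\<And>i j. i \<in> {1..n} \<Longrightarrow> j \<in> {1..n} \<Longrightarrow> i + 1 < j \<Longrightarrow> f i \<bullet> f j = 0"
    using ch by (auto simp: chain_def)
  have img: "f ` {1..n} = P"
    using card_subset_eq[OF finite_P sub] card_image[OF inj] by (simp only: n_def card_atLeastAtMost diff_Suc_1 One_nat_def)
  have fP: "f i \<in> P" if "i \<in> {1..n}" for i using sub that by blast
  have ne: "f i \<noteq> f j" if "i \<in> {1..n}" "j \<in> {1..n}" "i \<noteq> j" for i j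
    using inj_on_eq_iff[OF inj] that by blast
  have adj: "f (i + 1) \<bullet> f i \<noteq> 0" if "i \<in> {1..<n}" for i
    using c1[OF that] unfolding cartan_def by (metis divide_eq_0_iff mult_zero_right neg_equal_0_iff_equal zero_neq_one)
  have up: "cf \<theta> (f (i + 1)) * cartan (f (i + 1)) (f i) \<le> -1"
    and down: "cf \<theta> (f i) * cartan (f i) (f (i + 1)) \<le> -1" if "i \<in> {1..<n}" for i
    using that adj[OF that] neighbour_term(3)[OF fP fP ne, of "i + 1" i]
      neighbour_term(3)[OF fP fP ne, of i "i + 1"] by (auto simp: inner_commute)
  obtain m where m: "m \<in> {1..n}" "f m = b" using img ab(2) by blast
  have m1: "m \<noteq> 1" using m f1 ab(3) by auto
  have "m = n"
  proof (rule ccontr)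
    \<comment> \<open>Were \<open>b\<close> an interior node, its two neighbours would use up the
      whole 2 and leave \<open>cartan \<theta> b \<le> 0\<close>.\<close>
    assume "m \<noteq> n"
    then have i: "m \<in> {1..<n}" "m - 1 \<in> {1..<n}" using m m1 by auto
    have j: "m + 1 \<in> {1..n}" "m - 1 \<in> {1..n}" "m + 1 \<noteq> m" "m - 1 \<noteq> m" "m + 1 \<noteq> m - 1"
      using i m1 by auto
    have B: "{f (m + 1), f (m - 1)} \<subseteq> P - {f m}"
      using fP[OF j(1)] fP[OF j(2)] ne[OF j(1) m(1) j(3)] ne[OF j(2) m(1) j(4)] by simp
    have "m - 1 + 1 = m" using m(1) by simp
    then have "cf \<theta> (f (m - 1)) * cartan (f (m - 1)) (f m) \<le> -1" using down[OF i(2)] by simp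
    then have "(\<Sum>\<beta>\<in>{f (m + 1), f (m - 1)}. cf \<theta> \<beta> * cartan \<beta> (f m)) \<le> -2"
      using up[OF i(1)] ne[OF j(1,2,5)] by simp
    then have "cartan \<theta> (f m) \<le> 0"
      using cartan_theta_bound[OF fP[OF m(1)] cf1[OF m(1)] B] by linarith
    moreover have "cartan \<theta> (f m) \<ge> 1" unfolding m(2) by (rule cartan_theta_ends) simp
    ultimately show False by linarith
  qed
  then have fn: "f n = b" using m by simp
  have n2: "n \<noteq> 1" using m m1 by auto
  have single: "cartan \<theta> (f i) \<le> 1"
    if i: "i \<in> {1..n}" "j \<in> {1..n}" "i \<noteq> j" and t: "cf \<theta> (f j) * cartan (f j) (f i) \<le> -1" for i j
  proof -
    have "{f j} \<subseteq> P - {f i}" using fP[OF i(2)] ne[OF i(1,2,3)] by blast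
    from cartan_theta_bound[OF fP[OF i(1)] cf1[OF i(1)] this] show ?thesis using t by simp
  qed
  have "a \<bullet> a = \<theta> \<bullet> \<theta>"
  proof -
    have "cartan \<theta> (f 1) \<le> 1" using n1 n2 up[of 1] by (intro single[of 1 "1 + 1"]) auto
    then show ?thesis using end_long[of a] f1 by simp
  qed
  moreover have "b \<bullet> b = \<theta> \<bullet> \<theta>"
  proof -
    have "n - 1 \<in> {1..<n}" "n - 1 + 1 = n" using n1 n2 by auto
    then have "cartan \<theta> (f n) \<le> 1"
      using down[of "n - 1"] n1 by (intro single[of n "n - 1"]) auto
    then show ?thesis using end_long[of b] fn by simp
  qed
  ultimately have ends_eq: "f 1 \<bullet> f 1 = f n \<bullet> f n" using f1 fn by simp
  have step: "f (i + 1) \<bullet> f (i + 1) \<le> f i \<bullet> f i" if i: "i \<in> {1..<n}" for i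
  proof -
    have "cartan (f i) (f (i + 1)) \<le> -1" using down[OF i] cf1[of i] i by simp
    moreover have "f i \<bullet> f i > 0" "f (i + 1) \<bullet> f (i + 1) > 0"
      using inner_pos P_in_R fP i by auto
    \<comment> \<open>The two Cartan integers of a link express the same inner product through the
      two lengths.\<close>
    ultimately have "2 * (f i \<bullet> f (i + 1)) \<le> - (f (i + 1) \<bullet> f (i + 1))"
      "2 * (f i \<bullet> f (i + 1)) = - (f i \<bullet> f i)"
      using c1[OF i] by (simp_all add: cartan_def divide_le_eq divide_eq_eq inner_commute)
    then show ?thesis by simp
  qed
  have anti: "f j \<bullet> f j \<le> f i \<bullet> f i" if "1 \<le> i" "i \<le> j" "j \<le> n" for i j
    using that(2,1,3)
  proof (induction j rule: dec_induct)
    case (step j)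
    then show ?case using \<open>\<And>i. i \<in> {1..<n} \<Longrightarrow> f (i + 1) \<bullet> f (i + 1) \<le> f i \<bullet> f i\<close>[of j] by simp
  qed simp
  have norm_eq: "f i \<bullet> f i = f 1 \<bullet> f 1" if "i \<in> {1..n}" for i
    using anti[of 1 i] anti[of i n] ends_eq that by auto
  have c2: "cartan (f i) (f (i + 1)) = -1" if i: "i \<in> {1..<n}" for i
    using c1[OF i] norm_eq[of i] norm_eq[of "i + 1"] i by (simp add: cartan_def inner_commute)
  have "2 * (f i \<bullet> f j) / (f j \<bullet> f j) = -1 \<and> 2 * (f i \<bullet> f j) / (f i \<bullet> f i) = -1"
    if "i \<in> {1..n}" "j \<in> {1..n}" "i = j + 1 \<or> j = i + 1" for i j
    using that c1[of i] c1[of j] c2[of i] c2[of j] by (auto simp: cartan_def inner_commute)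
  moreover have "f i \<bullet> f j = 0"
    if "i \<in> {1..n}" "j \<in> {1..n}" "i \<noteq> j" "\<not> (i = j + 1 \<or> j = i + 1)" for i j
    using that far[of i j] far[of j i] by (cases i j rule: linorder_cases) (auto simp: inner_commute)
  moreover have "bij_betw f {1..n} P" using inj img by (simp add: bij_betw_def)
  ultimately show ?thesis unfolding type_A_def by (intro exI[of _ n] exI[of _ f]) auto
qed

end

end

theorem theorem4p3:
  fixes R P S :: "'a::euclidean_space set" and \<theta> :: 'a
  assumes "root_system R" and "reduced R" and "irreducible_rs R"
    and "is_base R P"
    and "highest_root R P \<theta>"
    and "\<not> type_A P"
    and "S \<subseteq> simple_long_roots R P" and "S \<noteq> {}"
  shows "bij_betw (\<lambda>\<eta>. \<theta> - \<eta>)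
           (minimal_elems P (\<Inter>\<alpha>\<in>S. I_min R P \<theta> \<alpha>))
           (maximal_elems P (pos_roots R P - (\<Union>\<alpha>\<in>S. I_max R P \<theta> \<alpha>)))"
proof -
  have "simple_long_roots R P \<noteq> {}" using assms(7,8) by blast
  then interpret highest_root_system R P \<theta>
    by (intro highest_root_system.intro based_root_system.intro highest_root_system_axioms.intro assms(1,2,4,5))
  \<comment> \<open>Since \<open>\<theta> \<bullet> \<theta> > 0\<close>, some simple root pairs
    positively with \<open>\<theta>\<close>; outside type A it is the only one and differs from
    \<open>\<theta>\<close>.\<close>
  obtain \<alpha>\<^sub>0 where a0: "\<alpha>\<^sub>0 \<in> P" "\<theta> \<bullet> \<alpha>\<^sub>0 > 0"
    using ex_simple_inner_pos[OF inner_pos[OF theta_in_R]] pos_cf_nonneg[OF theta_pos] by blast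
  have "\<alpha>\<^sub>0 \<noteq> \<theta>" using theta_eq_simple_type_A a0(1) assms(6) by blast
  moreover have "\<beta> = \<alpha>\<^sub>0" if "\<beta> \<in> P" "\<beta> \<bullet> \<theta> > 0" for \<beta>
    using two_ends_type_A[OF assms(3) that(1) a0(1) _ _ a0(2)] assms(6) that(2)
    unfolding inner_commute[of \<beta>] by blast
  moreover have "\<alpha>\<^sub>0 \<bullet> \<theta> > 0" using a0(2) by (simp only: inner_commute)
  ultimately show ?thesis
    using a0(1) assms(7,8) by (intro bij_minimal_maximal)
qed

end
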